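(* Let $N\ge 2$, $p,q\in(1,\infty)$, $R>0$, $f\in C[0,R)$, and set $\kappa=\frac{p-1}{q-1}$ and $d=\frac{(N-1)(q-1)}{p-1}+1$. Let $u$ be a bounded radial viscosity supersolution to $-|Du|^{q-2}\Delta_p^N u=f(|x|)$ in $B_R\subset\mathbb{R}^N$. Then $v(r):=u(re_1)$ is a weak supersolution to $-\kappa\Delta_q^d v\ge f$ in $(0,R)$.
   Context: $B_R\subset\mathbb{R}^N$ is the open ball of radius $R$ centred at the origin; $e_1$ is the first standard basis vector. A function $u$ is radial if $u(x)$ depends only on $|x|$. Viscosity supersolutions. The normalized $p$-Laplacian is $\Delta_p^N u=\Delta u+\frac{p-2}{|Du|^2}\sum_{i,j=1}^N D_{ij}u\,D_iu\,D_ju$. A function $\varphi$ touches $u$ from below at $x_0\in B_R$ if $\varphi(x_0)=u(x_0)$ and $\varphi(x)<u(x)$ for $x\ne x_0$ in a neighbourhood of $x_0$. A bounded lower semicontinuous $u:B_R\to\mathbb{R}$ is a viscosity supersolution to $-|Du|^{q-2}\Delta_p^N u=f(|x|)$ in $B_R$ if whenever $\varphi$ is $C^2$ near $x_0\in B_R$, touches $u$ from below at $x_0$, and $D\varphi(x)\neq0$ for $x\ne x_0$ near $x_0$, then $$\limsup_{x_0\ne y\to x_0}\big(-|D\varphi(y)|^{q-2}\Delta_p^N\varphi(y)\big)-f(|x_0|)\ge0.$$ Weighted spaces. $L^q(r^{d-1},(0,R))$ is the set of measurable $v:(0,R)\to\mathbb{R}$ with $\int_0^R|v|^q r^{d-1}\,dr<\infty$.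 $W^{1,q}(r^{d-1},(0,R))$ is the set of $v\in L^q(r^{d-1},(0,R))$ whose distributional derivative $v'$ on $(0,R)$ belongs to $L^q(r^{d-1},(0,R))$. Weak supersolutions. Formally $\Delta_q^d v=|v'|^{q-2}\big((q-1)v''+\frac{d-1}{r}v'\big)$. A function $v$ is a weak supersolution to $-\kappa\Delta_q^d v\ge f$ in $(0,R)$ if $v\in W^{1,q}(r^{d-1},(0,R'))$ for all $R'\in(0,R)$ and $$\int_0^R \kappa|v'|^{q-2}v'\varphi' r^{d-1}-\varphi f r^{d-1}\,dr\ge 0$$ for all non-negative $\varphi\in C_0^\infty(-R,R)$ (note: test functions need not vanish at $0$). *)

theory Defs
  imports "HOL-Analysis.Analysis"
begin

section \<open>Viscosity supersolutions\<close>

definition partial_deriv :: "'n::finite \<Rightarrow> (real^'n \<Rightarrow> real) \<Rightarrow> real^'n \<Rightarrow> real" where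
  "partial_deriv i \<phi> x = frechet_derivative \<phi> (at x) (axis i 1)"

definition gradient :: "(real^'n::finite \<Rightarrow> real) \<Rightarrow> real^'n \<Rightarrow> real^'n" where
  "gradient \<phi> x = (\<chi> i. partial_deriv i \<phi> x)"

definition hess :: "(real^'n::finite \<Rightarrow> real) \<Rightarrow> real^'n \<Rightarrow> 'n \<Rightarrow> 'n \<Rightarrow> real" where
  "hess \<phi> x i j = partial_deriv i (partial_deriv j \<phi>) x"

definition C2_near :: "(real^'n::finite \<Rightarrow> real) \<Rightarrow> real^'n \<Rightarrow> bool" where
  "C2_near \<phi> x\<^sub>0 \<longleftrightarrow> (\<exists>U. open U \<and> x\<^sub>0 \<in> U \<and>
     (\<forall>x\<in>U. \<phi> differentiable (at x)) \<and>
     (\<forall>j. \<forall>x\<in>U. partial_deriv j \<phi> differentiable (at x)) \<and>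
     (\<forall>i j. continuous_on U (\<lambda>x. hess \<phi> x i j)))"

definition normalized_p_laplacian :: "real \<Rightarrow> (real^'n::finite \<Rightarrow> real) \<Rightarrow> real^'n \<Rightarrow> real" where
  "normalized_p_laplacian p \<phi> x =
     (\<Sum>i\<in>UNIV. hess \<phi> x i i)
     + (p - 2) / (norm (gradient \<phi> x))\<^sup>2 *
       (\<Sum>i\<in>UNIV. \<Sum>j\<in>UNIV. hess \<phi> x i j * partial_deriv i \<phi> x * partial_deriv j \<phi> x)"

definition touches_from_below ::
    "(real^'n::finite \<Rightarrow> real) \<Rightarrow> (real^'n \<Rightarrow> real) \<Rightarrow> real^'n \<Rightarrow> bool" where
  "touches_from_below \<phi> u x\<^sub>0 \<longleftrightarrow> \<phi> x\<^sub>0 = u x\<^sub>0 \<and> (\<forall>\<^sub>F x in at x\<^sub>0. \<phi> x < u x)"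

definition lower_semicontinuous_on :: "'a::topological_space set \<Rightarrow> ('a \<Rightarrow> real) \<Rightarrow> bool" where
  "lower_semicontinuous_on S u \<longleftrightarrow> (\<forall>x\<in>S. \<forall>c<u x. \<forall>\<^sub>F y in at x within S. c < u y)"

definition radial_on :: "'a::real_normed_vector set \<Rightarrow> ('a \<Rightarrow> real) \<Rightarrow> bool" where
  "radial_on S u \<longleftrightarrow> (\<forall>x\<in>S. \<forall>y\<in>S. norm x = norm y \<longrightarrow> u x = u y)"

text \<open>
  Bounded viscosity supersolutions to \<open>-|Du|^(q-2) \<Delta>\<^sub>p\<^sup>N u = f(|x|)\<close> in the ball of radius
  \<open>R\<close>. Functions on the ball are represented by total functions whose values outside the ball
  are irrelevant. The upper limit may be infinite, hence it is taken in the extended reals.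
\<close>

definition viscosity_supersolution ::
    "real \<Rightarrow> real \<Rightarrow> (real \<Rightarrow> real) \<Rightarrow> real \<Rightarrow> (real^'n::finite \<Rightarrow> real) \<Rightarrow> bool" where
  "viscosity_supersolution p q f R u \<longleftrightarrow>
     bounded (u ` ball 0 R) \<and> lower_semicontinuous_on (ball 0 R) u \<and>
     (\<forall>x\<^sub>0\<in>ball 0 R. \<forall>\<phi>.
        C2_near \<phi> x\<^sub>0 \<and> touches_from_below \<phi> u x\<^sub>0 \<and> (\<forall>\<^sub>F x in at x\<^sub>0. gradient \<phi> x \<noteq> 0) \<longrightarrow>
        Limsup (at x\<^sub>0)
          (\<lambda>y. ereal (- (norm (gradient \<phi> y) powr (q - 2)) * normalized_p_laplacian p \<phi> y))
          - ereal (f (norm x\<^sub>0)) \<ge> 0)"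

section \<open>Weighted Sobolev spaces and weak supersolutions\<close>

text \<open>Compactly supported smooth functions on \<open>(a,b)\<close>, extended by zero to the real line.\<close>

definition test_functions :: "real \<Rightarrow> real \<Rightarrow> (real \<Rightarrow> real) set" where
  "test_functions a b = {\<phi>. (\<forall>n. (deriv ^^ n) \<phi> differentiable_on UNIV) \<and>
     compact (closure {x. \<phi> x \<noteq> 0}) \<and> closure {x. \<phi> x \<noteq> 0} \<subseteq> {a<..<b}}"

definition weighted_Lq :: "real \<Rightarrow> real \<Rightarrow> real \<Rightarrow> (real \<Rightarrow> real) set" where
  "weighted_Lq q d R = {v. set_borel_measurable lebesgue {0<..<R} v \<and>
     set_integrable lebesgue {0<..<R} (\<lambda>r. \<bar>v r\<bar> powr q * r powr (d - 1))}"

definition locally_integrable_on :: "real \<Rightarrow> real \<Rightarrow> (real \<Rightarrow> real) \<Rightarrow> bool" where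
  "locally_integrable_on a b v \<longleftrightarrow>
     (\<forall>K. compact K \<and> K \<subseteq> {a<..<b} \<longrightarrow> set_integrable lebesgue K v)"

definition has_distributional_derivative ::
    "(real \<Rightarrow> real) \<Rightarrow> (real \<Rightarrow> real) \<Rightarrow> real \<Rightarrow> real \<Rightarrow> bool" where
  "has_distributional_derivative v w a b \<longleftrightarrow>
     locally_integrable_on a b v \<and> locally_integrable_on a b w \<and>
     (\<forall>\<phi>\<in>test_functions a b.
        (LINT r:{a<..<b}|lebesgue. v r * deriv \<phi> r) = - (LINT r:{a<..<b}|lebesgue. w r * \<phi> r))"

definition weighted_W1q :: "real \<Rightarrow> real \<Rightarrow> real \<Rightarrow> (real \<Rightarrow> real) set" where
  "weighted_W1q q d R = {v. v \<in> weighted_Lq q d R \<and>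
     (\<exists>w\<in>weighted_Lq q d R. has_distributional_derivative v w 0 R)}"

text \<open>
  Weak supersolutions to \<open>-\<kappa> \<Delta>\<^sub>q\<^sup>d v \<ge> f\<close> in \<open>(0,R)\<close>. The distributional derivative \<open>w\<close> of \<open>v\<close> is
  unique up to a null set, so it does not matter which representative is chosen. The
  integrability requirement makes explicit that the integral exists, since the library integral
  of a non-integrable function is 0. The test functions live on \<open>(-R,R)\<close> and need not vanish at 0.
\<close>

definition weak_supersolution ::
    "real \<Rightarrow> real \<Rightarrow> real \<Rightarrow> (real \<Rightarrow> real) \<Rightarrow> real \<Rightarrow> (real \<Rightarrow> real) \<Rightarrow> bool" where
  "weak_supersolution \<kappa> q d f R v \<longleftrightarrow>
     (\<forall>R'\<in>{0<..<R}. v \<in> weighted_W1q q d R') \<and>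
     (\<exists>w. has_distributional_derivative v w 0 R \<and>
        (\<forall>\<phi>\<in>test_functions (-R) R. (\<forall>r. \<phi> r \<ge> 0) \<longrightarrow>
           set_integrable lebesgue {0<..<R}
             (\<lambda>r. \<kappa> * \<bar>w r\<bar> powr (q - 2) * w r * deriv \<phi> r * r powr (d - 1)
                  - \<phi> r * f r * r powr (d - 1)) \<and>
           (LINT r:{0<..<R}|lebesgue.
              \<kappa> * \<bar>w r\<bar> powr (q - 2) * w r * deriv \<phi> r * r powr (d - 1)
              - \<phi> r * f r * r powr (d - 1)) \<ge> 0))"

end

theory Submission
  imports Defs
begin

text \<open>
  Let \<open>G\<close> be the primitive of \<open>f r^(d-1) / \<kappa>\<close> vanishing at 0. The claim amounts to
  \<open>|v'|^(q-2) v' r^(d-1) + G\<close> being nonincreasing on \<open>(0,R)\<close> with nonpositive limit at 0.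
  The solutions of \<open>|w'|^(q-2) w' r^(d-1) = C - G\<close> form a two-parameter family of curves, and monotonicity
  means that \<open>v\<close> is concave with respect to this family. To obtain this concavity, replace \<open>f\<close> by \<open>f - \<epsilon>\<close>,
  so that the curves become strict subsolutions, and compare them with \<open>v\<close> by doubling the variables: either a
  translate of \<open>w\<close> with nonzero slope touches \<open>v\<close> from below, or a high power \<open>-|x - x\<^sub>0|^(2m)\<close> does, which
  forces \<open>f \<le> 0\<close> at the contact point and contradicts the strictness of \<open>w\<close> there. As for concave functions, the
  generalised chord slopes are monotone, which gives local Lipschitz continuity and the derivative off a
  countable set. A positive limit of the flux at 0 would put \<open>v\<close> above a cone with vertex at the origin, where
  the paraboloids \<open>v 0 + x\<^sub>k + K |x|^2\<close> touch for all large \<open>K\<close>, contradicting the supersolution property.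
\<close>

text \<open>The constants come from the radial form of the operator. For a function of r = |x| the
  left side reads -|v'|^(q-2) ((p-1) v'' + (N-1) v'/r), and \<kappa> (q-1) = p-1, \<kappa> (d-1) =
  N-1 turn it into the divergence form -\<kappa> r^(1-d) (r^(d-1) |v'|^(q-2) v')'. Two obstacles
  shape the proof. Initially v is known only to be bounded and lower semicontinuous, so it cannot be
  differentiated. Moreover a comparison curve may be a bad test function where its slope vanishes:
  it need not be C^2 there if q > 2, and the operator is singular there if q < 2. Doubling separates
  the two cases: off the diagonal the penalty forces a nonzero slope, and on the diagonal the
  penalty itself is the test function. The strictness \<epsilon> can be removed afterwards because
  the fluxes obtained for different \<epsilon> describe one and the same derivative of v off a
  countable set.\<close>

section \<open>Countable exceptional sets and test functions on the line\<close>

text \<open>If \<open>h a > h b\<close>, every intermediate value \<open>y\<close> is attained for a last time; there the derivative, if it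
  exists, is not positive. Hence all of these values belong to the countable set \<open>h ` E\<close>.\<close>

lemma nondecreasing_countable_exceptions:
  fixes h :: "real \<Rightarrow> real"
  assumes ab: "a \<le> b" and cont: "continuous_on {a..b} h" and E: "countable E"
    and deriv: "\<And>x. x \<in> {a<..<b} - E \<Longrightarrow> \<exists>D\<ge>0. (h has_real_derivative D) (at x)"
  shows "h a \<le> h b"
proof (rule ccontr)
  assume "\<not> h a \<le> h b"
  then have hab: "h b < h a" by simp
  \<comment> \<open>Tilting by slope \<open>e\<close> uses up half of the drop
    \<open>h a - h b\<close>: \<open>g\<close> still decreases from \<open>a\<close> to
    \<open>b\<close>, while its derivative off \<open>E\<close> is now strictly positive.\<close>
  define e where "e = (h a - h b) / (2 * (b - a))"
  have "a < b" using hab ab by (cases "a = b") auto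
  then have e: "e > 0" using hab by (simp add: e_def)
  define g where "g x = h x + e * (x - a)" for x
  have "e * (b - a) = (h a - h b) / 2" using \<open>a < b\<close> by (simp add: e_def field_simps)
  then have gab: "g b < g a" using hab by (simp add: g_def)
  have gc: "continuous_on {a..b} g" unfolding g_def by (intro continuous_intros cont)
  have "{g b<..<g a} \<subseteq> g ` E"
  proof
    fix y assume y: "y \<in> {g b<..<g a}"
    define S where "S = {x \<in> {a..b}. y \<le> g x}"
    have "closed S" unfolding S_def
      using continuous_closed_preimage[OF gc closed_atLeastAtMost, of "{y..}"] by (simp add: vimage_def Int_def)
    have aS: "a \<in> S" using y ab by (simp add: S_def)
    have bd: "bdd_above S" by (auto simp: S_def)
    define x where "x = Sup S"
    have xS: "x \<in> S" unfolding x_def using \<open>closed S\<close> aS bd by (intro closed_contains_Sup) auto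
    have after: "g t < y" if "x < t" "t \<le> b" for t
    proof (rule ccontr)
      assume "\<not> g t < y"
      then have "t \<in> S" using that xS by (auto simp: S_def)
      then show False using cSup_upper[OF _ bd, of t] that by (simp add: x_def)
    qed
    have xb: "x < b" using xS y by (auto simp: S_def less_le)
    have gx: "g x = y"
    proof (rule ccontr)
      assume "g x \<noteq> y"
      then have "y < g x" using xS by (auto simp: S_def)
      moreover have "continuous_on {x..b} g" using xS by (intro continuous_on_subset[OF gc]) (auto simp: S_def)
      ultimately obtain t where "x \<le> t" "t \<le> b" "g t = y" using IVT2'[of g b y x] y xb by auto
      then show False using after[of t] \<open>g x \<noteq> y\<close> by (cases "x = t") auto
    qed
    have xa: "a < x" using xS gx y by (auto simp: S_def less_le)
    have "x \<in> E"
    proof (rule ccontr)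
      assume "x \<notin> E"
      then obtain D where D: "D \<ge> 0" "(h has_real_derivative D) (at x)" using deriv[of x] xa xb by auto
      have "(g has_real_derivative D + e) (at x)"
        unfolding g_def by (auto intro!: derivative_eq_intros D)
      from DERIV_pos_inc_right[OF this] D e obtain d where d: "d > 0" "\<And>t. 0 < t \<Longrightarrow> t < d \<Longrightarrow> g x < g (x + t)"
        by auto
      define t where "t = min (d / 2) (b - x)"
      have "0 < t" "t < d" "x + t \<le> b" using d xb by (auto simp: t_def)
      then show False using d(2)[of t] after[of "x + t"] gx by auto
    qed
    then show "y \<in> g ` E" using gx by auto
  qed
  then have "countable {g b<..<g a}" using E countable_subset countable_image by metis
  then show False using gab uncountable_open_interval by metis
qed

text \<open>Continuity of \<open>g\<close> off \<open>E\<close> makes its primitive differentiable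
  there, with the same derivative as \<open>h\<close>. Both differences of \<open>h\<close> and the
  primitive then have derivative 0 off a countable set, so they are nondecreasing.\<close>

lemma fundamental_theorem_countable_exceptions:
  fixes h g :: "real \<Rightarrow> real"
  assumes ab: "a \<le> b" and cont: "continuous_on {a..b} h" and g: "g integrable_on {a..b}" and E: "countable E"
    and deriv: "\<And>x. x \<in> {a<..<b} - E \<Longrightarrow> (h has_real_derivative g x) (at x)"
    and gc: "\<And>x. x \<in> {a<..<b} - E \<Longrightarrow> isCont g x"
  shows "integral {a..b} g = h b - h a"
proof -
  define \<Psi> where "\<Psi> x = integral {a..x} g" for x
  have c: "continuous_on {a..b} \<Psi>"
    unfolding \<Psi>_def using g by (rule indefinite_integral_continuous_1)
  have D: "(\<Psi> has_real_derivative g x) (at x)" if x: "x \<in> {a<..<b} - E" for x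
  proof -
    have "(\<Psi> has_vector_derivative g x) (at x within {a..b} - {})"
      unfolding \<Psi>_def[abs_def] using x
      by (intro integral_has_vector_derivative_continuous_at g)
        (auto intro: continuous_at_imp_continuous_at_within[OF gc])
    then show ?thesis using x by (simp add: has_real_derivative_iff_has_vector_derivative at_within_Icc_at)
  qed
  have "h a - \<Psi> a \<le> h b - \<Psi> b"
  proof (rule nondecreasing_countable_exceptions[OF ab _ E, of "\<lambda>x. h x - \<Psi> x"])
    show "\<exists>D\<ge>0. ((\<lambda>x. h x - \<Psi> x) has_real_derivative D) (at x)" if "x \<in> {a<..<b} - E" for x
      using DERIV_diff[OF deriv[OF that] D[OF that]] by (intro exI[of _ 0]) simp
  qed (intro continuous_intros c cont)
  moreover have "\<Psi> a - h a \<le> \<Psi> b - h b"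
  proof (rule nondecreasing_countable_exceptions[OF ab _ E, of "\<lambda>x. \<Psi> x - h x"])
    show "\<exists>D\<ge>0. ((\<lambda>x. \<Psi> x - h x) has_real_derivative D) (at x)" if "x \<in> {a<..<b} - E" for x
      using DERIV_diff[OF D[OF that] deriv[OF that]] by (intro exI[of _ 0]) simp
  qed (intro continuous_intros c cont)
  ultimately show ?thesis by (simp add: \<Psi>_def)
qed

section \<open>Measurability, test functions and set integrals\<close>

lemma borel_measurable_lebesgue_on_mono_on:
  fixes f :: "real \<Rightarrow> real"
  assumes "mono_on A f" shows "f \<in> borel_measurable (lebesgue_on A)"
  using borel_measurable_mono_on_fnc[OF assms]
  by (rule borel_measurable_subalgebra[rotated 2])
    (auto simp: sets_restrict_space space_restrict_space)

lemma absolutely_integrable_bounded: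
  fixes f :: "real \<Rightarrow> real"
  assumes "f \<in> borel_measurable (lebesgue_on {a..b})" "\<And>x. x \<in> {a..b} \<Longrightarrow> \<bar>f x\<bar> \<le> K"
  shows "f absolutely_integrable_on {a..b}"
  using assms by (intro measurable_bounded_by_integrable_imp_absolutely_integrable[where g = "\<lambda>_. K"]) auto

lemma test_function_smooth:
  assumes "\<phi> \<in> test_functions a b"
  shows "(\<phi> has_real_derivative deriv \<phi> x) (at x)" "continuous_on A \<phi>" "continuous_on A (deriv \<phi>)"
proof -
  have "(deriv ^^ 0) \<phi> differentiable_on UNIV" "(deriv ^^ 1) \<phi> differentiable_on UNIV"
    using assms unfolding test_functions_def by blast+
  then have d: "\<phi> differentiable_on UNIV" "deriv \<phi> differentiable_on UNIV" by simp_all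
  then show "continuous_on A \<phi>" "continuous_on A (deriv \<phi>)"
    by (meson differentiable_imp_continuous_on continuous_on_subset subset_UNIV)+
  show "(\<phi> has_real_derivative deriv \<phi> x) (at x)"
    using d(1) by (auto simp: differentiable_on_def intro: DERIV_deriv_iff_real_differentiable[THEN iffD2])
qed

lemma compact_in_open_interval:
  fixes K :: "real set"
  assumes "compact K" "K \<subseteq> {a<..<b}" "a < b"
  obtains s t where "a < s" "s < t" "t < b" "K \<subseteq> {s<..<t}"
proof (cases "K = {}")
  case True
  obtain s where "a < s" "s < b" using assms dense by blast
  moreover obtain t where "s < t" "t < b" using \<open>s < b\<close> dense by blast
  ultimately show thesis using that True by blast
next
  case False
  obtain l where l: "l \<in> K" "\<And>x. x \<in> K \<Longrightarrow> l \<le> x" using compact_attains_inf[OF assms(1) False] by blast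
  obtain m where m: "m \<in> K" "\<And>x. x \<in> K \<Longrightarrow> x \<le> m" using compact_attains_sup[OF assms(1) False] by blast
  have "a < l" "m < b" using l(1) m(1) assms(2) by auto
  then obtain s t where s: "a < s" "s < l" and t: "m < t" "t < b" using dense by meson
  have "s < t" using s t l(2)[OF m(1)] by simp
  moreover have "K \<subseteq> {s<..<t}" using s t l m by force
  ultimately show thesis using that s t by blast
qed

lemma test_function_support:
  assumes phi: "\<phi> \<in> test_functions a b" and "a < b"
  obtains s t where "a < s" "s < t" "t < b" "\<And>x. x \<notin> {s<..<t} \<Longrightarrow> \<phi> x = 0 \<and> deriv \<phi> x = 0"
proof -
  define K where "K = closure {x. \<phi> x \<noteq> 0}"
  have K: "compact K" "K \<subseteq> {a<..<b}" using phi by (auto simp: test_functions_def K_def)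
  obtain s t where st: "a < s" "s < t" "t < b" "K \<subseteq> {s<..<t}"
    using compact_in_open_interval[OF K \<open>a < b\<close>] .
  have 0: "\<phi> x = 0" if "x \<notin> K" for x using that closure_subset[of "{x. \<phi> x \<noteq> 0}"] by (auto simp: K_def)
  have "deriv \<phi> x = 0" if "x \<notin> K" for x
  proof -
    have "((\<lambda>x. 0) has_real_derivative 0) (at x)" by simp
    then have "(\<phi> has_real_derivative 0) (at x)"
      by (rule has_field_derivative_transform_within_open[of _ _ _ "- K"])
        (use 0 that K(1) in \<open>auto simp: compact_imp_closed open_Compl\<close>)
    then show ?thesis by (rule DERIV_imp_deriv)
  qed
  then show thesis using that[of s t] st 0 by blast
qed

text \<open>Bridge from the Lebesgue set integrals of the definitions to gauge integrals over a
  closed interval, where the calculus takes place. The two end points form a null set, so only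
  values on the open interval matter.\<close>

lemma set_integral_restrict:
  fixes g :: "real \<Rightarrow> real"
  assumes g: "g absolutely_integrable_on {s..t}" and sub: "{s<..<t} \<subseteq> A" and z: "\<And>x. x \<in> A - {s<..<t} \<Longrightarrow> h x = 0"
    and eq: "\<And>x. x \<in> {s<..<t} \<Longrightarrow> h x = g x"
  shows "set_integrable lebesgue A h" "(LINT x:A|lebesgue. h x) = integral {s..t} g"
proof -
  have "(\<lambda>x. indicator A x *\<^sub>R h x) = (\<lambda>x. indicator {s<..<t} x *\<^sub>R g x)"
    using sub z eq by (force simp: fun_eq_iff indicator_def)
  moreover have "set_integrable lebesgue {s<..<t} g"
    by (rule set_integrable_subset[OF g]) auto
  ultimately show "set_integrable lebesgue A h" "(LINT x:A|lebesgue. h x) = integral {s..t} g"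
    using set_lebesgue_integral_eq_integral(2)[of "{s<..<t}" g]
    by (simp_all add: set_integrable_def set_lebesgue_integral_def integral_open_interval_real)
qed

section \<open>Radial touching\<close>

text \<open>Explicit gradient vectors for \<open>\<phi>\<close> and for each component of its
  gradient identify the chosen \<open>frechet_derivative\<close> by uniqueness.
  \<open>Hs x j\<close> is the gradient of the \<open>j\<close>-th component, hence the order of
  indices.\<close>

lemma C2_nearI:
  fixes \<phi> :: "real^'n::finite \<Rightarrow> real"
  assumes U: "open U" "x0 \<in> U"
    and D: "\<And>x. x \<in> U \<Longrightarrow> (\<phi> has_derivative (\<lambda>t. Dg x \<bullet> t)) (at x)"
    and H: "\<And>x j. x \<in> U \<Longrightarrow> ((\<lambda>x. Dg x $ j) has_derivative (\<lambda>t. Hs x j \<bullet> t)) (at x)"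
    and C: "\<And>j. continuous_on U (\<lambda>x. Hs x j)"
  shows "C2_near \<phi> x0"
    and "\<And>x. x \<in> U \<Longrightarrow> gradient \<phi> x = Dg x"
    and "\<And>x i j. x \<in> U \<Longrightarrow> hess \<phi> x i j = Hs x j $ i"
proof -
  have pd: "partial_deriv j \<phi> x = Dg x $ j" if "x \<in> U" for x j
    using frechet_derivative_at[OF D[OF that]]
    by (simp add: partial_deriv_def inner_axis flip: fun_eq_iff) (metis inner_axis inner_real_def mult.right_neutral)
  then show "\<And>x. x \<in> U \<Longrightarrow> gradient \<phi> x = Dg x"
    by (simp add: gradient_def vec_eq_iff)
  have pd2: "(partial_deriv j \<phi> has_derivative (\<lambda>t. Hs x j \<bullet> t)) (at x)" if "x \<in> U" for x j
    using H[OF that] by (rule has_derivative_transform_within_open[OF _ U(1) that]) (simp add: pd)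
  show he: "\<And>x i j. x \<in> U \<Longrightarrow> hess \<phi> x i j = Hs x j $ i"
    unfolding hess_def partial_deriv_def[of _ "partial_deriv _ _"]
    by (subst frechet_derivative_at[OF pd2, symmetric]) (auto simp: inner_axis)
  have "continuous_on U (\<lambda>x. hess \<phi> x i j)" for i j
    using continuous_on_component[OF C[of j], of i] by (simp add: he cong: continuous_on_cong)
  moreover have "\<phi> differentiable (at x)" "partial_deriv j \<phi> differentiable (at x)" if "x \<in> U" for x j
    using D[OF that] pd2[OF that] unfolding differentiable_def by blast+
  ultimately show "C2_near \<phi> x0"
    unfolding C2_near_def using U by (intro exI[of _ U]) simp
qed

lemma has_derivative_sqdist:
  fixes z x :: "real^'n::finite"
  assumes "(h has_real_derivative h') (at ((x - z) \<bullet> (x - z)))"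
  shows "((\<lambda>x. h ((x - z) \<bullet> (x - z))) has_derivative (\<lambda>t. ((2 * h') *\<^sub>R (x - z)) \<bullet> t)) (at x)"
proof -
  have "((\<lambda>x. (x - z) \<bullet> (x - z)) has_derivative (\<lambda>t. 2 * ((x - z) \<bullet> t))) (at x)"
    by (auto intro!: derivative_eq_intros simp: inner_commute)
  from has_derivative_compose[OF this, of h "\<lambda>t. h' * t"] assms
  have "((\<lambda>x. h ((x - z) \<bullet> (x - z))) has_derivative (\<lambda>t. h' * (2 * ((x - z) \<bullet> t)))) (at x)"
    by (simp add: has_field_derivative_def)
  then show ?thesis by (simp add: mult.assoc mult.left_commute)
qed

text \<open>One family contains all test functions used: a profile \<open>h\<close> about the
  origin, a linear term that keeps the gradient nonzero at the origin, and a term \<open>s\<close>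
  centred at the contact point. Writing the profiles in squared distances avoids differentiating the
  norm at its singular point.\<close>

lemma radial_test_function:
  fixes x0 :: "real^'n::finite" and h h1 h2 s s1 s2 :: "real \<Rightarrow> real" and a :: real and k :: 'n
  assumes T: "open T" "x0 \<bullet> x0 \<in> T"
    and h: "\<And>t. t \<in> T \<Longrightarrow> (h has_real_derivative h1 t) (at t)"
      "\<And>t. t \<in> T \<Longrightarrow> (h1 has_real_derivative h2 t) (at t)" "continuous_on T h2"
    and s: "\<And>t. (s has_real_derivative s1 t) (at t)"
      "\<And>t. (s1 has_real_derivative s2 t) (at t)" "continuous_on UNIV s2"
  defines "\<phi> \<equiv> \<lambda>x. h (x \<bullet> x) + a * x $ k + s ((x - x0) \<bullet> (x - x0))"
  shows "C2_near \<phi> x0"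
    and "x \<bullet> x \<in> T \<Longrightarrow> gradient \<phi> x =
      (2 * h1 (x \<bullet> x)) *\<^sub>R x + a *\<^sub>R axis k 1 + (2 * s1 ((x - x0) \<bullet> (x - x0))) *\<^sub>R (x - x0)"
    and "x \<bullet> x \<in> T \<Longrightarrow> hess \<phi> x i j =
      4 * h2 (x \<bullet> x) * x $ i * x $ j + (if i = j then 2 * h1 (x \<bullet> x) else 0) +
      (4 * s2 ((x - x0) \<bullet> (x - x0)) * (x - x0) $ i * (x - x0) $ j
        + (if i = j then 2 * s1 ((x - x0) \<bullet> (x - x0)) else 0))"
proof -
  define U where "U = {x::real^'n. x \<bullet> x \<in> T}"
  define Dg where "Dg x = (2 * h1 (x \<bullet> x)) *\<^sub>R x + a *\<^sub>R axis k 1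
    + (2 * s1 ((x - x0) \<bullet> (x - x0))) *\<^sub>R (x - x0)" for x
  define Hs where "Hs x j = (4 * h2 (x \<bullet> x) * x $ j) *\<^sub>R x + (2 * h1 (x \<bullet> x)) *\<^sub>R axis j 1 +
      ((4 * s2 ((x - x0) \<bullet> (x - x0)) * (x - x0) $ j) *\<^sub>R (x - x0)
        + (2 * s1 ((x - x0) \<bullet> (x - x0))) *\<^sub>R axis j 1)" for x :: "real^'n" and j
  have "open U"
    unfolding U_def vimage_def[symmetric, of "\<lambda>x. x \<bullet> x", unfolded mem_Collect_eq]
    by (intro open_vimage T continuous_intros)
  have "x0 \<in> U" using T by (simp add: U_def)
  have D: "(\<phi> has_derivative (\<lambda>t. Dg x \<bullet> t)) (at x)" if "x \<in> U" for x
  proof -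
    have 1: "((\<lambda>x. h (x \<bullet> x)) has_derivative (\<lambda>t. ((2 * h1 (x \<bullet> x)) *\<^sub>R x) \<bullet> t)) (at x)"
      using has_derivative_sqdist[of h "h1 (x \<bullet> x)" x 0] h(1)[of "x \<bullet> x"] that
      by (simp add: U_def)
    have 2: "((\<lambda>x. a * x $ k) has_derivative (\<lambda>t. (a *\<^sub>R axis k 1) \<bullet> t)) (at x)"
      by (auto intro!: derivative_eq_intros bounded_linear_imp_has_derivative[OF bounded_linear_vec_nth]
          simp: inner_axis')
    show ?thesis unfolding \<phi>_def Dg_def inner_add_left
      by (intro has_derivative_add 1 2 has_derivative_sqdist s)
  qed
  have H: "((\<lambda>x. Dg x $ j) has_derivative (\<lambda>t. Hs x j \<bullet> t)) (at x)" if "x \<in> U" for x j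
  proof -
    have c: "((\<lambda>x. x $ j - z) has_derivative (\<lambda>t. t $ j)) (at x)" for z
      by (auto intro!: derivative_eq_intros bounded_linear_imp_has_derivative[OF bounded_linear_vec_nth])
    have "((\<lambda>x. h1 (x \<bullet> x)) has_derivative (\<lambda>t. ((2 * h2 (x \<bullet> x)) *\<^sub>R x) \<bullet> t)) (at x)"
      using has_derivative_sqdist[of h1 "h2 (x \<bullet> x)" x 0] h(2)[of "x \<bullet> x"] that
      by (simp add: U_def)
    from has_derivative_mult[OF has_derivative_mult_right[OF this, of 2] c[of 0]]
    have 1: "((\<lambda>x. 2 * h1 (x \<bullet> x) * x $ j) has_derivative
       (\<lambda>t. ((4 * h2 (x \<bullet> x) * x $ j) *\<^sub>R x + (2 * h1 (x \<bullet> x)) *\<^sub>R axis j 1) \<bullet> t)) (at x)"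
      by (simp add: inner_add_left inner_axis' algebra_simps)
    have 2: "((\<lambda>x. 2 * s1 ((x - x0) \<bullet> (x - x0)) * (x $ j - x0 $ j)) has_derivative
       (\<lambda>t. ((4 * s2 ((x - x0) \<bullet> (x - x0)) * (x - x0) $ j) *\<^sub>R (x - x0)
        + (2 * s1 ((x - x0) \<bullet> (x - x0))) *\<^sub>R axis j 1) \<bullet> t)) (at x)"
      by (rule has_derivative_eq_rhs[OF has_derivative_mult[OF
            has_derivative_mult_right[OF has_derivative_sqdist[OF s(2)], of 2] c[of "x0 $ j"]]])
        (simp add: fun_eq_iff inner_add_left inner_axis' mult_ac(2,3))
    have 3: "((\<lambda>x. a * axis k 1 $ j) has_derivative (\<lambda>t. 0)) (at x)"
      by simp
    have "((\<lambda>x. 2 * h1 (x \<bullet> x) * x $ j + a * axis k 1 $ j + 2 * s1 ((x - x0) \<bullet> (x - x0)) * (x $ j - x0 $ j))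
      has_derivative (\<lambda>t. Hs x j \<bullet> t)) (at x)"
      by (rule has_derivative_eq_rhs[OF has_derivative_add[OF has_derivative_add[OF 1 3] 2]])
        (simp add: Hs_def inner_add_left fun_eq_iff)
    then show ?thesis by (simp add: Dg_def)
  qed
  have cont1: "continuous_on T h1" "continuous_on UNIV s1"
    using h(2) s(2) DERIV_continuous_on has_field_derivative_at_within by blast+
  have "continuous_on U (\<lambda>x. x \<bullet> x)" "continuous_on U (\<lambda>x. (x - x0) \<bullet> (x - x0))"
    by (intro continuous_intros)+
  then have cont2: "continuous_on U (\<lambda>x. h1 (x \<bullet> x))" "continuous_on U (\<lambda>x. h2 (x \<bullet> x))"
    "continuous_on U (\<lambda>x. s1 ((x - x0) \<bullet> (x - x0)))" "continuous_on U (\<lambda>x. s2 ((x - x0) \<bullet> (x - x0)))"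
    by (auto intro: continuous_on_compose2[OF h(3)] continuous_on_compose2[OF s(3)]
        continuous_on_compose2[OF cont1(1)] continuous_on_compose2[OF cont1(2)] simp: U_def)
  have C: "continuous_on U (\<lambda>x. Hs x j)" for j
    unfolding Hs_def
    by (intro continuous_intros cont2)
  note * = C2_nearI[OF \<open>open U\<close> \<open>x0 \<in> U\<close> D H C]
  show "C2_near \<phi> x0" by (rule *)
  show "x \<bullet> x \<in> T \<Longrightarrow> gradient \<phi> x =
      (2 * h1 (x \<bullet> x)) *\<^sub>R x + a *\<^sub>R axis k 1 + (2 * s1 ((x - x0) \<bullet> (x - x0))) *\<^sub>R (x - x0)"
    using *(2)[of x] by (simp add: U_def Dg_def)
  show "x \<bullet> x \<in> T \<Longrightarrow> hess \<phi> x i j =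
      4 * h2 (x \<bullet> x) * x $ i * x $ j + (if i = j then 2 * h1 (x \<bullet> x) else 0) +
      (4 * s2 ((x - x0) \<bullet> (x - x0)) * (x - x0) $ i * (x - x0) $ j
        + (if i = j then 2 * s1 ((x - x0) \<bullet> (x - x0)) else 0))"
    using *(3)[of x i j] by (simp add: U_def Hs_def axis_def mult_ac)
qed

text \<open>The gradient direction \<open>z\<close> is an eigenvector of the Hessian A z z^T + B I
  with eigenvalue A |z|^2 + B. The normalized term adds p - 2 times this eigenvalue to the trace,
  whatever the length of the gradient.\<close>

lemma normalized_p_laplacian_rank_one:
  fixes x z :: "real^'n::finite"
  assumes H: "\<And>i j. hess \<phi> x i j = A * z $ i * z $ j + (if i = j then B else 0)"
    and G: "gradient \<phi> x = l *\<^sub>R z" and nz: "l \<noteq> 0" "z \<noteq> 0"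
  shows "normalized_p_laplacian p \<phi> x = (p - 1) * A * (z \<bullet> z) + B * (real CARD('n) + p - 2)"
proof -
  have pd: "partial_deriv i \<phi> x = l * z $ i" for i
    using G by (simp add: gradient_def vec_eq_iff)
  have zz: "(\<Sum>i\<in>UNIV. z $ i * z $ i) = z \<bullet> z"
    by (simp add: inner_vec_def)
  have tr: "(\<Sum>i\<in>UNIV. hess \<phi> x i i) = A * (z \<bullet> z) + B * real CARD('n)"
    by (simp add: H sum.distrib mult.assoc zz flip: sum_distrib_left)
  have "(\<Sum>j\<in>UNIV. hess \<phi> x i j * partial_deriv i \<phi> x * partial_deriv j \<phi> x)
      = l\<^sup>2 * (A * (z \<bullet> z) + B) * (z $ i * z $ i)" for i
  proof -
    have "(\<Sum>j\<in>UNIV. hess \<phi> x i j * partial_deriv i \<phi> x * partial_deriv j \<phi> x)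
      = (\<Sum>j\<in>UNIV. (l\<^sup>2 * A * (z $ i * z $ i)) * (z $ j * z $ j) + (if i = j then l\<^sup>2 * B * (z $ i * z $ i) else 0))"
      by (intro sum.cong refl) (auto simp: H pd power2_eq_square algebra_simps)
    also have "\<dots> = (l\<^sup>2 * A * (z $ i * z $ i)) * (z \<bullet> z) + l\<^sup>2 * B * (z $ i * z $ i)"
      by (simp add: sum.distrib zz flip: sum_distrib_left)
    finally show ?thesis by (simp add: algebra_simps)
  qed
  then have qf: "(\<Sum>i\<in>UNIV. \<Sum>j\<in>UNIV. hess \<phi> x i j * partial_deriv i \<phi> x * partial_deriv j \<phi> x)
      = l\<^sup>2 * (A * (z \<bullet> z) + B) * (z \<bullet> z)"
    by (simp add: zz flip: sum_distrib_left)
  have "(norm (gradient \<phi> x))\<^sup>2 = l\<^sup>2 * (z \<bullet> z)"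
    by (simp add: G power_mult_distrib power2_norm_eq_inner)
  moreover have "(p - 2) / (l\<^sup>2 * (z \<bullet> z)) * (l\<^sup>2 * (A * (z \<bullet> z) + B) * (z \<bullet> z))
      = (p - 2) * (A * (z \<bullet> z) + B)"
    using nz by simp
  ultimately show ?thesis
    unfolding normalized_p_laplacian_def tr qf by (simp only: algebra_simps)
qed

text \<open>Where the gradient is nonzero the operator is continuous, so the upper limit in the
  definition is the value at the point.\<close>

lemma viscosity_supersolution_noncritical:
  fixes u :: "real^'n::finite \<Rightarrow> real"
  assumes visc: "viscosity_supersolution p q f R u" and x0: "x0 \<in> ball 0 R"
    and C2: "C2_near \<phi> x0" and touch: "touches_from_below \<phi> u x0" and nz: "gradient \<phi> x0 \<noteq> 0"
  shows "f (norm x0) \<le> - (norm (gradient \<phi> x0) powr (q - 2)) * normalized_p_laplacian p \<phi> x0"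
proof -
  obtain U where U: "open U" "x0 \<in> U" 
    and D: "\<And>x. x\<in>U \<Longrightarrow> \<phi> differentiable (at x)"
    and pd: "\<And>j x. x\<in>U \<Longrightarrow> partial_deriv j \<phi> differentiable (at x)"
    and H: "\<And>i j. continuous_on U (\<lambda>x. hess \<phi> x i j)"
    using C2 unfolding C2_near_def by auto
  have cp: "isCont (partial_deriv j \<phi>) x0" for j
    using pd[OF U(2)] differentiable_imp_continuous_within by blast
  have ch: "isCont (\<lambda>x. hess \<phi> x i j) x0" for i j
    using H U continuous_on_eq_continuous_at by blast
  have cg: "isCont (gradient \<phi>) x0"
    unfolding gradient_def[abs_def] using cp
    by (auto simp: isCont_def intro!: vec_tendstoI)
  have ev: "\<forall>\<^sub>F x in at x0. gradient \<phi> x \<noteq> 0"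
    using cg nz unfolding isCont_def by (rule tendsto_imp_eventually_ne)
  define P where "P y = - (norm (gradient \<phi> y) powr (q - 2)) * normalized_p_laplacian p \<phi> y" for y
  have "(P \<longlongrightarrow> P x0) (at x0)"
    unfolding P_def normalized_p_laplacian_def using nz
    by (intro tendsto_intros cg[unfolded isCont_def] ch[unfolded isCont_def] cp[unfolded isCont_def])
      simp_all
  then have "((\<lambda>y. ereal (P y)) \<longlongrightarrow> ereal (P x0)) (at x0)"
    by simp
  then have "Limsup (at x0) (\<lambda>y. ereal (P y)) = ereal (P x0)"
    by (intro lim_imp_Limsup) auto
  moreover have "Limsup (at x0) (\<lambda>y. ereal (P y)) - ereal (f (norm x0)) \<ge> 0"
    using visc x0 C2 touch ev unfolding viscosity_supersolution_def P_def by blast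
  ultimately show ?thesis by (simp add: P_def)
qed

section \<open>The supersolution as a function of the radius\<close>

locale radial_supersolution =
  fixes p q R :: real and f :: "real \<Rightarrow> real" and u :: "real^'n::finite \<Rightarrow> real" and k :: 'n
  assumes p: "1 < p" and q: "1 < q" and R: "0 < R"
    and visc: "viscosity_supersolution p q f R u" and radial: "radial_on (ball 0 R) u"
begin

definition v :: "real \<Rightarrow> real" where "v r = u (r *\<^sub>R axis k 1)"

lemma u_eq: "x \<in> ball 0 R \<Longrightarrow> u x = v (norm x)"
  using radial unfolding radial_on_def v_def by (elim ballE[of _ _ x] ballE[of _ _ "norm x *\<^sub>R axis k 1"]) simp_all

text \<open>The test function is g(|x|) - |x - x0|^4. The quartic term makes the touching strict,
  and its first and second derivatives vanish at x0, so it does not affect the operator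
  there.\<close>

lemma radial_touching_noncritical:
  assumes r0: "a < r0" "r0 < b" and ab: "0 < a" "b \<le> R"
    and g: "\<And>r. r \<in> {a<..<b} \<Longrightarrow> (g has_real_derivative g1 r) (at r)"
      "\<And>r. r \<in> {a<..<b} \<Longrightarrow> (g1 has_real_derivative g2 r) (at r)" "continuous_on {a<..<b} g2"
    and le: "\<And>r. r \<in> {a<..<b} \<Longrightarrow> g r \<le> v r" and eq: "g r0 = v r0" and nz: "g1 r0 \<noteq> 0"
  shows "f r0 \<le> - (\<bar>g1 r0\<bar> powr (q - 2)) * ((p - 1) * g2 r0 + (real CARD('n) - 1) * g1 r0 / r0)"
proof -
  define T where "T = {a\<^sup>2<..<b\<^sup>2}"
  define x0 :: "real^'n" where "x0 = r0 *\<^sub>R axis k 1"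
  \<comment> \<open>These are the first two derivatives of g (sqrt t). At t = r^2 one has 2
    \<open>h1\<close> = g'/r and 4 t \<open>h2\<close> = g'' - g'/r, so (p-1) 4 t \<open>h2\<close>
    + 2 \<open>h1\<close> (N+p-2) becomes (p-1) g'' + (N-1) g'/r.\<close>
  define h1 where "h1 t = g1 (sqrt t) / (2 * sqrt t)" for t
  define h2 where "h2 t = (g2 (sqrt t) - g1 (sqrt t) / sqrt t) / (4 * t)" for t
  define \<phi> where "\<phi> x = g (sqrt (x \<bullet> x)) + 0 * x $ k + (- ((x - x0) \<bullet> (x - x0))\<^sup>2)" for x
  have sq: "sqrt t \<in> {a<..<b}" "t > 0" if "t \<in> T" for t
    using that ab r0 unfolding T_def
    by (auto simp: real_less_rsqrt real_less_lsqrt intro: less_trans[of 0 "a\<^sup>2"])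
  have img: "sqrt ` T \<subseteq> {a<..<b}" "\<forall>t\<in>T. sqrt t \<noteq> 0" "\<forall>t\<in>T. 4 * t \<noteq> 0"
    using sq by force+
  have x0: "x0 \<bullet> x0 = r0\<^sup>2" "norm x0 = r0" "x0 \<noteq> 0"
    using r0 ab by (auto simp: x0_def inner_axis' power2_eq_square)
  have T: "open T" "x0 \<bullet> x0 \<in> T"
    using r0 ab by (auto simp: T_def x0 intro!: power_strict_mono)
  have h: "((\<lambda>t. g (sqrt t)) has_real_derivative h1 t) (at t)"
    "(h1 has_real_derivative h2 t) (at t)" if "t \<in> T" for t
  proof -
    have s: "(sqrt has_real_derivative 1 / (2 * sqrt t)) (at t)"
      using DERIV_real_sqrt[OF sq(2)[OF that]] by (simp add: field_simps)
    show "((\<lambda>t. g (sqrt t)) has_real_derivative h1 t) (at t)"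
      using DERIV_chain2[OF g(1)[OF sq(1)[OF that]] s] by (simp add: h1_def)
    have "((\<lambda>t. g1 (sqrt t) / (2 * sqrt t)) has_real_derivative h2 t) (at t)"
      using sq(2)[OF that]
      by (auto intro!: derivative_eq_intros DERIV_chain2[OF g(2)[OF sq(1)[OF that]] s] s
          simp: h2_def field_simps power2_eq_square)
    then show "(h1 has_real_derivative h2 t) (at t)" by (simp add: h1_def[abs_def])
  qed
  have g1c: "continuous_on {a<..<b} g1"
    by (rule DERIV_continuous_on[of _ _ g2]) (rule has_field_derivative_at_within[OF g(2)])
  have h2c: "continuous_on T h2"
    unfolding h2_def
    by (intro continuous_intros continuous_on_compose2[OF g(3)] continuous_on_compose2[OF g1c])
      (use img in auto)
  have s: "((\<lambda>t. - t\<^sup>2) has_real_derivative - 2 * t) (at t)"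
    "((\<lambda>t. - 2 * t) has_real_derivative - 2) (at t)" for t :: real
    by (auto intro!: derivative_eq_intros)
  note test = radial_test_function[of T x0, OF T h h2c s, where a = 0 and k = k, folded \<phi>_def[abs_def], simplified]
  have "C2_near \<phi> x0" by (rule test(1))
  have gr: "gradient \<phi> x0 = (g1 r0 / r0) *\<^sub>R x0"
    using r0 ab T by (simp add: test(2) h1_def x0)
  have he: "hess \<phi> x0 i j = 4 * h2 (x0 \<bullet> x0) * x0 $ i * x0 $ j + (if i = j then g1 r0 / r0 else 0)" for i j
    using r0 ab T by (simp add: test(3) h1_def x0)
  have "normalized_p_laplacian p \<phi> x0 =
      (p - 1) * (4 * h2 (x0 \<bullet> x0)) * (x0 \<bullet> x0) + g1 r0 / r0 * (real CARD('n) + p - 2)"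
    by (rule normalized_p_laplacian_rank_one[OF he gr]) (use nz r0 ab x0 in auto)
  also have "\<dots> = (p - 1) * g2 r0 + (real CARD('n) - 1) * g1 r0 / r0"
    using r0 ab by (simp add: x0 h2_def field_simps)
  finally have lap: "normalized_p_laplacian p \<phi> x0 = (p - 1) * g2 r0 + (real CARD('n) - 1) * g1 r0 / r0" .
  have "\<forall>\<^sub>F x in at x0. norm x \<in> {a<..<b}"
    by (rule topological_tendstoD[OF tendsto_norm[OF tendsto_ident_at]]) (use r0 x0 in auto)
  moreover have "\<forall>\<^sub>F x in at x0. x \<noteq> x0"
    by (rule eventually_neq_at_within)
  ultimately have "\<forall>\<^sub>F x in at x0. \<phi> x < u x"
  proof eventually_elim
    case (elim x)
    have "\<phi> x < g (norm x)"
      using elim by (simp add: \<phi>_def norm_eq_sqrt_inner)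
    also have "\<dots> \<le> v (norm x)" using elim by (intro le)
    also have "\<dots> = u x" using elim ab by (intro u_eq[symmetric]) auto
    finally show ?case .
  qed
  then have "touches_from_below \<phi> u x0"
    using eq r0 ab by (simp add: touches_from_below_def \<phi>_def x0) (simp add: x0_def v_def)
  from viscosity_supersolution_noncritical[OF visc _ \<open>C2_near \<phi> x0\<close> this]
  have "f r0 \<le> - (norm (gradient \<phi> x0) powr (q - 2)) * normalized_p_laplacian p \<phi> x0"
    using nz r0 ab x0 by (simp add: gr)
  then show ?thesis
    using r0 ab unfolding lap by (simp add: gr x0)
qed

text \<open>The exponent \<open>2m\<close> is so large that the operator applied to the test function tends to 0
  at the critical point, even if \<open>q < 2\<close>.\<close>

lemma radial_touching_critical:
  assumes r0: "0 < r0" "r0 < R" and c: "0 \<le> c" and m: "2 \<le> m" "(2 * real m - 1) * (q - 1) > 1"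
    and le: "\<forall>\<^sub>F r in nhds r0. v r0 - c * (r - r0) ^ (2 * m) \<le> v r"
  shows "f r0 \<le> 0"
proof -
  define x0 :: "real^'n" where "x0 = r0 *\<^sub>R axis k 1"
  \<comment> \<open>Any constant above \<open>c\<close> turns the weak inequality \<open>le\<close>
    into strict touching.\<close>
  define C where "C = c + 1"
  define s1 s2 where "s1 t = - C * real m * t ^ (m - 1)"
    and "s2 t = - C * real m * real (m - 1) * t ^ (m - 2)" for t :: real
  define \<phi> where "\<phi> x = v r0 + 0 * x $ k + (- C * ((x - x0) \<bullet> (x - x0)) ^ m)" for x
  define K where "K = 4 * C * real m * real (m - 1) * (p - 1) + 2 * C * real m * (real CARD('n) + p - 2)"
  obtain n where n: "m = Suc (Suc n)"
    using m(1) by (metis add_2_eq_Suc le_Suc_ex)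
  have C: "C > 0" "C > c" using c by (auto simp: C_def)
  have x0: "norm x0 = r0" using r0 by (simp add: x0_def)
  have h: "((\<lambda>t::real. v r0) has_real_derivative 0) (at t)" "((\<lambda>t::real. 0) has_real_derivative 0) (at t)" for t
    by auto
  have s: "((\<lambda>t. - C * t ^ m) has_real_derivative s1 t) (at t)" "(s1 has_real_derivative s2 t) (at t)" for t
    unfolding s1_def s2_def using m(1)
    by (auto intro!: derivative_eq_intros simp: numeral_2_eq_2)
  have s2c: "continuous_on UNIV s2" unfolding s2_def by (intro continuous_intros)
  note test = radial_test_function[of UNIV x0, OF open_UNIV UNIV_I h continuous_on_const s s2c,
      where a = 0 and k = k, folded \<phi>_def[abs_def], simplified]
  have gr: "gradient \<phi> y = (2 * s1 ((y - x0) \<bullet> (y - x0))) *\<^sub>R (y - x0)" for y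
    by (rule test(2))
  have s1nz: "s1 ((y - x0) \<bullet> (y - x0)) \<noteq> 0" if "y \<noteq> x0" for y
    using that C m by (simp add: s1_def)
  have pw: "((y - x0) \<bullet> (y - x0)) ^ (m - 1) = norm (y - x0) ^ (2 * m - 2)" for y
    by (simp add: n flip: power2_norm_eq_inner power_mult) (simp add: power2_eq_square)
  have lap: "normalized_p_laplacian p \<phi> y = - K * norm (y - x0) ^ (2 * m - 2)" if "y \<noteq> x0" for y
  proof -
    let ?t = "(y - x0) \<bullet> (y - x0)"
    have "normalized_p_laplacian p \<phi> y =
      (p - 1) * (4 * s2 ?t) * ?t + 2 * s1 ?t * (real CARD('n) + p - 2)"
      by (rule normalized_p_laplacian_rank_one[OF _ gr]) (use test(3) s1nz that in \<open>simp_all\<close>)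
    also have "s2 ?t * ?t = - C * real m * real (m - 1) * ?t ^ (m - 1)"
      by (simp add: s2_def n)
    then have "(p - 1) * (4 * s2 ?t) * ?t = (p - 1) * 4 * (- C * real m * real (m - 1) * ?t ^ (m - 1))"
      by (simp add: mult.assoc)
    finally show ?thesis
      unfolding s1_def pw K_def by (simp add: algebra_simps)
  qed
  have ngr: "norm (gradient \<phi> y) = 2 * C * real m * norm (y - x0) ^ (2 * m - 1)" for y
  proof -
    have "norm (y - x0) ^ (2 * m - 2) * norm (y - x0) = norm (y - x0) ^ (2 * m - 1)"
      by (simp add: n)
    then show ?thesis using C
      unfolding gr s1_def pw by (simp add: abs_mult mult.assoc)
  qed
  define P where "P y = - (norm (gradient \<phi> y) powr (q - 2)) * normalized_p_laplacian p \<phi> y" for y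
  \<comment> \<open>Total power of |y - x0| in the operator: the gradient, of order 2m-1, raised to
    q-2, times the Laplacian, of order 2m-2. It equals (2m-1)(q-1) - 1, which is positive by the
    choice of \<open>m\<close>.\<close>
  define e where "e = (2 * real m - 1) * (q - 2) + (2 * real m - 2)"
  have e: "e > 0" using m(2) by (simp add: e_def algebra_simps)
  have P: "P y = (2 * C * real m) powr (q - 2) * K * norm (y - x0) powr e" if "y \<noteq> x0" for y
  proof -
    have n: "norm (y - x0) > 0" using that by simp
    have *: "norm (y - x0) ^ (2 * m - 1) = norm (y - x0) powr (2 * real m - 1)"
      "norm (y - x0) ^ (2 * m - 2) = norm (y - x0) powr (2 * real m - 2)"
      using m(1) n by (simp_all add: powr_realpow[symmetric] of_nat_diff)
    show ?thesis
      unfolding P_def ngr lap[OF that] * e_def using C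
      by (simp add: powr_mult powr_powr powr_add)
  qed
  have "((\<lambda>y. (2 * C * real m) powr (q - 2) * K * norm (y - x0) powr e) \<longlongrightarrow>
      (2 * C * real m) powr (q - 2) * K * norm (x0 - x0) powr e) (at x0)"
    by (intro tendsto_mult tendsto_const tendsto_powr' tendsto_norm tendsto_diff tendsto_ident_at) (use e in auto)
  then have "((\<lambda>y. (2 * C * real m) powr (q - 2) * K * norm (y - x0) powr e) \<longlongrightarrow> 0) (at x0)"
    by simp
  then have "(P \<longlongrightarrow> 0) (at x0)"
    by (rule Lim_transform_eventually) (auto simp: eventually_at_filter P)
  then have "((\<lambda>y. ereal (P y)) \<longlongrightarrow> ereal 0) (at x0)"
    by simp
  then have LS: "Limsup (at x0) (\<lambda>y. ereal (P y)) = ereal 0"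
    by (intro lim_imp_Limsup) auto
  have "\<forall>\<^sub>F x in at x0. norm x \<in> {0<..<R}"
    by (rule topological_tendstoD[OF tendsto_norm[OF tendsto_ident_at]]) (use r0 x0 in auto)
  moreover have "\<forall>\<^sub>F x in at x0. v r0 - c * (norm x - r0) ^ (2 * m) \<le> v (norm x)"
    using le tendsto_norm[OF tendsto_ident_at[of x0 UNIV]] unfolding x0 by (rule eventually_compose_filterlim)
  moreover have neq: "\<forall>\<^sub>F x in at x0. x \<noteq> x0"
    by (rule eventually_neq_at_within)
  ultimately have "\<forall>\<^sub>F x in at x0. \<phi> x < u x"
  proof eventually_elim
    case (elim x)
    have "(norm x - r0) ^ (2 * m) = \<bar>norm x - r0\<bar> ^ (2 * m)" by (simp add: power_even_abs)
    \<comment> \<open>The reverse triangle inequality carries the one-dimensional lower bound over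
      to the ball.\<close>
    also have "\<dots> \<le> norm (x - x0) ^ (2 * m)"
      using norm_triangle_ineq3[of x x0] by (intro power_mono) (auto simp: x0)
    also have "norm (x - x0) ^ (2 * m) = ((x - x0) \<bullet> (x - x0)) ^ m"
      by (simp add: power_mult flip: power2_norm_eq_inner)
    finally have 1: "(norm x - r0) ^ (2 * m) \<le> ((x - x0) \<bullet> (x - x0)) ^ m" .
    have "\<phi> x < v r0 - c * ((x - x0) \<bullet> (x - x0)) ^ m"
      using elim C by (simp add: \<phi>_def)
    also have "\<dots> \<le> v r0 - c * (norm x - r0) ^ (2 * m)"
      using 1 c by (simp add: mult_left_mono)
    also have "\<dots> \<le> v (norm x)" using elim by simp
    also have "\<dots> = u x" using elim by (intro u_eq[symmetric]) auto
    finally show ?case .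
  qed
  then have "touches_from_below \<phi> u x0"
    using m(1) by (simp add: touches_from_below_def \<phi>_def power_0_left) (simp add: x0_def v_def)
  moreover have "C2_near \<phi> x0" by (rule test(1))
  moreover have "\<forall>\<^sub>F x in at x0. gradient \<phi> x \<noteq> 0"
    using neq by eventually_elim (use s1nz in \<open>simp add: gr\<close>)
  moreover have "x0 \<in> ball 0 R" using x0 r0 by simp
  ultimately have "Limsup (at x0) (\<lambda>y. ereal (P y)) - ereal (f (norm x0)) \<ge> 0"
    using visc unfolding viscosity_supersolution_def P_def by blast
  then show ?thesis unfolding LS x0 by simp
qed

text \<open>Slope 2 of the cone leaves room for both parts of the test function: the unit linear
  term, which makes the gradient at 0 nonzero, and K |x|^2, which is below |x| for |x| < 1/K. The
  operator at 0 is then -2K(N+p-2), which a large \<open>K\<close> pushes below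
  \<open>f 0\<close>.\<close>

lemma no_corner_at_origin:
  assumes s: "0 < s" and le: "\<And>r. 0 < r \<Longrightarrow> r < s \<Longrightarrow> v 0 + 2 * r \<le> v r"
  shows False
proof -
  define N where "N = real CARD('n) + p - 2"
  have "real CARD('n) \<ge> 1" by (simp add: Suc_leI)
  then have N: "N > 0" using p unfolding N_def by linarith
  \<comment> \<open>With this choice the supersolution inequality reads f 0 \<le> -2 (|f 0| + 1),
    which is impossible.\<close>
  define K where "K = (\<bar>f 0\<bar> + 1) / N"
  have K: "K > 0" "K * N = \<bar>f 0\<bar> + 1" using N by (auto simp: K_def)
  define \<phi> where "\<phi> x = (v 0 + K * (x \<bullet> x)) + 1 * x $ k + 0 * ((x - 0) \<bullet> (x - 0))" for x :: "real^'n"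
  have h: "((\<lambda>t::real. v 0 + K * t) has_real_derivative K) (at t)" "((\<lambda>t::real. K) has_real_derivative 0) (at t)" for t
    by (auto intro!: derivative_eq_intros)
  have s': "((\<lambda>t::real. 0 * t) has_real_derivative 0) (at t)" "((\<lambda>t::real. 0) has_real_derivative 0) (at t)" for t
    by auto
  note test = radial_test_function[of UNIV 0, OF open_UNIV UNIV_I h continuous_on_const s' continuous_on_const,
      where a = 1 and k = k, folded \<phi>_def[abs_def], simplified]
  have gr: "gradient \<phi> 0 = 1 *\<^sub>R axis k 1" using test(2)[of 0] by simp
  have lap: "normalized_p_laplacian p \<phi> 0 = (p - 1) * 0 * (axis k 1 \<bullet> (axis k 1 :: real^'n)) + 2 * K * (real CARD('n) + p - 2)"
    by (rule normalized_p_laplacian_rank_one[OF _ gr]) (auto simp: test(3))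
  have "0 < min (min s R) (1 / K)" using s R K by simp
  then have "\<forall>\<^sub>F x in at 0. x \<in> ball (0::real^'n) (min (min s R) (1 / K))"
    by (intro eventually_at_in_open'[OF open_ball]) simp
  then have "\<forall>\<^sub>F x in at 0. norm (x::real^'n) < min (min s R) (1 / K) \<and> x \<noteq> 0"
    using eventually_neq_at_within[of 0 0] by eventually_elim auto
  then have "\<forall>\<^sub>F x in at 0. \<phi> x < u x"
  proof eventually_elim
    case (elim x)
    have "K * (x \<bullet> x) < norm x"
      using elim K by (simp add: field_simps flip: power2_norm_eq_inner) (simp add: power2_eq_square)
    moreover have "x $ k \<le> norm x" using component_le_norm_cart[of x k] by simp
    ultimately have "\<phi> x < v 0 + 2 * norm x" by (simp add: \<phi>_def)
    also have "\<dots> \<le> v (norm x)" using elim by (intro le) auto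
    also have "\<dots> = u x" using elim by (intro u_eq[symmetric]) auto
    finally show ?case .
  qed
  then have "touches_from_below \<phi> u 0"
    by (simp add: touches_from_below_def \<phi>_def) (simp add: v_def)
  moreover have "C2_near \<phi> 0" by (rule test(1))
  ultimately have "f (norm (0::real^'n)) \<le> - (norm (gradient \<phi> 0) powr (q - 2)) * normalized_p_laplacian p \<phi> 0"
    by (intro viscosity_supersolution_noncritical[OF visc]) (use R gr in auto)
  also have "\<dots> = - 2 * (K * N)" by (simp add: gr lap N_def)
  finally show False unfolding K by simp
qed

end

section \<open>Comparison with strict subsolutions\<close>

text \<open>For a = 1/(q-1) this is the inverse of the map sending s to |s|^(q-2) s; it recovers a
  slope from its flux.\<close>

definition spow :: "real \<Rightarrow> real \<Rightarrow> real" where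
  "spow a t = sgn t * \<bar>t\<bar> powr a"

lemma spow_0 [simp]: "spow a 0 = 0"
  and spow_pos: "t \<ge> 0 \<Longrightarrow> spow a t = t powr a"
  and spow_minus: "spow a (- t) = - spow a t"
  and spow_eq_0_iff [simp]: "spow a t = 0 \<longleftrightarrow> t = 0"
  and abs_spow: "\<bar>spow a t\<bar> = \<bar>t\<bar> powr a"
  by (auto simp: spow_def sgn_if abs_mult)

lemma continuous_spow: "0 < a \<Longrightarrow> continuous_on UNIV (spow a)"
proof -
  assume a: "0 < a"
  have eq: "spow a = (\<lambda>t. max t 0 powr a - max (- t) 0 powr a)"
    by (auto simp: spow_def sgn_if fun_eq_iff)
  show ?thesis unfolding eq
    by (intro continuous_on_diff continuous_on_powr' continuous_on_max continuous_intros) (use a in auto)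
qed

lemma spow_less: assumes "0 < a" "s < t" shows "spow a s < spow a t"
proof -
  have nonneg: "spow a x < spow a y" if "0 \<le> x" "x < y" for x y
    using that assms(1) by (simp add: spow_pos powr_less_mono2)
  consider "0 \<le> s" | "t \<le> 0" | "s < 0" "0 < t" using assms(2) by linarith
  then show ?thesis
  proof cases
    case 1 then show ?thesis using nonneg[of s t] assms by simp
  next
    case 2 then show ?thesis using nonneg[of "- t" "- s"] assms by (simp add: spow_minus)
  next
    case 3
    then have "spow a s < 0" "0 < spow a t" by (simp_all add: spow_def)
    then show ?thesis by simp
  qed
qed

lemma spow_mono: "0 < a \<Longrightarrow> s \<le> t \<Longrightarrow> spow a s \<le> spow a t"
  using spow_less[of a s t] by (cases "s = t") auto

lemma DERIV_spow:
  assumes "t \<noteq> 0" shows "(spow a has_real_derivative a * \<bar>t\<bar> powr (a - 1)) (at t)"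
proof (cases "t > 0")
  case True
  have "((\<lambda>t. t powr a) has_real_derivative a * \<bar>t\<bar> powr (a - 1)) (at t)"
    using True by (auto intro!: derivative_eq_intros)
  then show ?thesis
    by (rule has_field_derivative_transform_within_open[of _ _ _ "{0<..}"]) (use True in \<open>auto simp: spow_pos\<close>)
next
  case False
  have "((\<lambda>t. - ((- t) powr a)) has_real_derivative a * \<bar>t\<bar> powr (a - 1)) (at t)"
    using False assms by (auto intro!: derivative_eq_intros)
  then show ?thesis
    by (rule has_field_derivative_transform_within_open[of _ _ _ "{..<0}"]) (use False assms in \<open>auto simp: spow_def sgn_if\<close>)
qed

text \<open>The first identity inverts the flux. The second cancels the factor |w'|^(q-2) of the
  operator against the derivative of the inverse power, so that |w'|^(q-2) w'' = A'/(q-1) for w' =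
  \<open>spow (1 / (q - 1)) A\<close> and A nonzero.\<close>

lemma spow_powr_cancel:
  assumes "1 < q"
  shows "\<bar>spow (1 / (q - 1)) t\<bar> powr (q - 2) * spow (1 / (q - 1)) t = t"
    and "t \<noteq> 0 \<Longrightarrow> \<bar>spow (1 / (q - 1)) t\<bar> powr (q - 2) * \<bar>t\<bar> powr (1 / (q - 1) - 1) = 1"
proof -
  have e: "1 / (q - 1) * (q - 2) + 1 / (q - 1) = 1" "1 / (q - 1) * (q - 2) + (1 / (q - 1) - 1) = 0"
    using assms by (simp_all add: field_simps)
  have 1: "\<bar>t\<bar> powr (1 / (q - 1) * (q - 2)) * \<bar>t\<bar> powr (1 / (q - 1)) = \<bar>t\<bar>" if "t \<noteq> 0"
    using that by (simp only: e powr_add[symmetric]) simp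
  show "\<bar>spow (1 / (q - 1)) t\<bar> powr (q - 2) * spow (1 / (q - 1)) t = t"
  proof (cases "t = 0")
    case False
    have "\<bar>spow (1 / (q - 1)) t\<bar> powr (q - 2) * spow (1 / (q - 1)) t
        = sgn t * (\<bar>t\<bar> powr (1 / (q - 1) * (q - 2)) * \<bar>t\<bar> powr (1 / (q - 1)))"
      unfolding abs_spow powr_powr by (simp add: spow_def)
    then show ?thesis unfolding 1[OF False] by (simp add: mult_sgn_abs)
  qed simp
  show "\<bar>spow (1 / (q - 1)) t\<bar> powr (q - 2) * \<bar>t\<bar> powr (1 / (q - 1) - 1) = 1" if "t \<noteq> 0"
    using that unfolding abs_spow powr_powr by (simp only: e powr_add[symmetric]) simp
qed

text \<open>Without a minimum every x is beaten by some \<open>g x\<close>, and by semicontinuity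
  \<open>g x\<close> also beats a neighbourhood of x. Finitely many such neighbourhoods cover
  S.\<close>

lemma lower_semicontinuous_attains_inf:
  fixes F :: "'a::topological_space \<Rightarrow> real"
  assumes S: "compact S" "S \<noteq> {}" and lsc: "lower_semicontinuous_on S F"
  obtains x where "x \<in> S" "\<And>y. y \<in> S \<Longrightarrow> F x \<le> F y"
proof -
  have "\<exists>x\<in>S. \<forall>y\<in>S. F x \<le> F y"
  proof (rule ccontr)
    assume "\<not> ?thesis"
    then obtain g where g: "\<And>x. x \<in> S \<Longrightarrow> g x \<in> S \<and> F (g x) < F x" by (metis not_le)
    have "\<exists>U. open U \<and> x \<in> U \<and> (\<forall>y\<in>U \<inter> S. F (g x) < F y)" if "x \<in> S" for x
    proof -
      have "\<forall>\<^sub>F y in at x within S. F (g x) < F y"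
        using lsc g that unfolding lower_semicontinuous_on_def by blast
      then obtain U where "open U" "x \<in> U" "\<forall>y\<in>U. y \<noteq> x \<longrightarrow> y \<in> S \<longrightarrow> F (g x) < F y"
        unfolding eventually_at_topological by blast
      then show ?thesis using g[OF that] by (intro exI[of _ U]) auto
    qed
    then obtain U where U: "\<And>x. x \<in> S \<Longrightarrow> open (U x) \<and> x \<in> U x \<and> (\<forall>y\<in>U x \<inter> S. F (g x) < F y)"
      by metis
    obtain D where D: "D \<subseteq> S" "finite D" "S \<subseteq> (\<Union>x\<in>D. U x)"
      using compactE_image[OF S(1), of S U] U by blast
    then have ne: "D \<noteq> {}" using S(2) by auto
    \<comment> \<open>The best of the finitely many competitors: \<open>g y\<close> lies in one of
      the covering neighbourhoods and is therefore beaten by another competitor.\<close>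
    define y where "y = arg_min_on (F \<circ> g) D"
    have y: "y \<in> D" "\<And>x. x \<in> D \<Longrightarrow> F (g y) \<le> F (g x)"
      using arg_min_if_finite(1)[OF D(2) ne, of "F \<circ> g"] arg_min_least[OF D(2) ne, of _ "F \<circ> g"]
      unfolding y_def by auto
    have "g y \<in> S" using y D g by blast
    then obtain x where x: "x \<in> D" "g y \<in> U x" using D by blast
    then have "F (g x) < F (g y)" using U[of x] D \<open>g y \<in> S\<close> by blast
    with y(2)[OF x(1)] show False by simp
  qed
  then show thesis using that by blast
qed

section \<open>The radial profile and its semicontinuity\<close>

locale radial_setting = radial_supersolution p q R f u k
  for p q R :: real and f :: "real \<Rightarrow> real" and u :: "real^'n::finite \<Rightarrow> real" and k :: 'n +
  fixes \<kappa> d :: real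
  assumes N: "CARD('n) \<ge> 2" and contf: "continuous_on {0..<R} f"
    and kappa: "\<kappa> = (p - 1) / (q - 1)" and dim: "d = (real CARD('n) - 1) * (q - 1) / (p - 1) + 1"
begin

lemma kappa_pos: "\<kappa> > 0" using p q by (simp add: kappa)
lemma d_gt_1: "d > 1" using p q N by (simp add: dim)
lemma kappa_dim: "\<kappa> * (d - 1) = real CARD('n) - 1" using p q by (simp add: dim kappa)

lemma v_lsc:
  assumes "0 \<le> r" "r < R" "c < v r"
  obtains e where "e > 0" "\<And>s. 0 \<le> s \<Longrightarrow> s < R \<Longrightarrow> \<bar>s - r\<bar> < e \<Longrightarrow> c < v s"
proof -
  have "lower_semicontinuous_on (ball 0 R) u" using visc by (simp add: viscosity_supersolution_def)
  then have "\<forall>\<^sub>F y in at (r *\<^sub>R axis k 1) within ball 0 R. c < u y"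
    using assms unfolding lower_semicontinuous_on_def v_def by auto
  then obtain e where e: "e > 0"
    "\<And>y. y \<in> ball 0 R \<Longrightarrow> y \<noteq> r *\<^sub>R axis k 1 \<Longrightarrow> dist y (r *\<^sub>R axis k 1) < e \<Longrightarrow> c < u y"
    unfolding eventually_at by blast
  show thesis
  proof (rule that[OF e(1)])
    fix s assume s: "0 \<le> s" "s < R" "\<bar>s - r\<bar> < e"
    have "dist (s *\<^sub>R axis k (1::real)) (r *\<^sub>R axis k 1 :: real^'n) = \<bar>s - r\<bar>"
      by (simp add: dist_norm flip: scaleR_diff_left)
    then show "c < v s"
      using e(2)[of "s *\<^sub>R axis k 1"] s assms by (cases "s = r") (auto simp: v_def)
  qed
qed

lemma v_bounded: obtains B where "\<And>r. 0 \<le> r \<Longrightarrow> r < R \<Longrightarrow> \<bar>v r\<bar> \<le> B"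
proof -
  have "bounded (u ` ball 0 R)" using visc by (simp add: viscosity_supersolution_def)
  then obtain B where "\<And>x. x \<in> ball 0 R \<Longrightarrow> \<bar>u x\<bar> \<le> B" unfolding bounded_iff by fastforce
  then show thesis by (intro that[of B]) (auto simp: v_def)
qed

text \<open>Lower semicontinuity in sequential form. It passes upper bounds for v to a limit point,
  including the origin, before any continuity of v is available.\<close>

lemma v_le_lim:
  assumes "\<And>n. 0 \<le> x n" "\<And>n. x n < R" "0 \<le> z" "z < R" "x \<longlonglongrightarrow> z" "c \<longlonglongrightarrow> l" "\<And>n. v (x n) \<le> c n"
  shows "v z \<le> l"
proof (rule ccontr)
  assume "\<not> v z \<le> l"
  then obtain c' where c': "l < c'" "c' < v z" using dense not_le by metis
  from v_lsc[OF assms(3,4) c'(2)] obtain e where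
    e: "e > 0" "\<And>s. 0 \<le> s \<Longrightarrow> s < R \<Longrightarrow> \<bar>s - z\<bar> < e \<Longrightarrow> c' < v s" by metis
  have "\<forall>\<^sub>F n in sequentially. \<bar>x n - z\<bar> < e"
    using tendstoD[OF assms(5) e(1)] by (simp add: dist_real_def)
  moreover have "\<forall>\<^sub>F n in sequentially. c n < c'"
    using assms(6) c'(1) by (rule order_tendstoD)
  ultimately have "\<forall>\<^sub>F n in sequentially. False"
    by eventually_elim (use e(2) assms in \<open>meson less_le_trans less_asym\<close>)
  then show False by simp
qed

end

text \<open>Strict subsolutions of the radial equation, in terms of \<open>A = |w'|^(q-2) w'\<close>.\<close>

locale strict_subsolution = radial_setting p q R f u k \<kappa> d
  for p q R f and u :: "real^'n::finite \<Rightarrow> real" and k \<kappa> d +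
  fixes a b \<epsilon> :: real and A w :: "real \<Rightarrow> real"
  assumes ab: "0 < a" "a < b" "b < R" and eps: "\<epsilon> > 0"
    and A: "\<And>r. a < r \<Longrightarrow> r < b \<Longrightarrow> (A has_real_derivative (1 - d) * A r / r - (f r - \<epsilon>) / \<kappa>) (at r)"
    and w: "\<And>r. a < r \<Longrightarrow> r < b \<Longrightarrow> (w has_real_derivative spow (1 / (q - 1)) (A r)) (at r)"
    and wc: "continuous_on {a..b} w"
begin

lemma f_cont: "continuous_on {a<..<b} f"
  by (rule continuous_on_subset[OF contf]) (use ab in auto)

text \<open>Freezing the second variable, the penalty touches v from below at x, so f x \<le> 0.
  Freezing the first, w - w x lies below the penalty, so A x = 0, and the equation for
  \<open>A\<close> gives A' x \<ge> \<epsilon>/\<kappa>. Hence w' grows to the right of x at least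
  like h^(1/(q-1)), faster than the slope of the penalty, which is of order h^(2m-1).\<close>

lemma doubled_min_diagonal:
  assumes m: "2 \<le> m" "(2 * real m - 1) * (q - 1) > 1" and x: "a < x" "x < b" and n: "n > 0"
    and min: "\<And>x' y'. x' \<in> {a..b} \<Longrightarrow> y' \<in> {a..b} \<Longrightarrow> v x - w x \<le> v x' - w y' + n * (x' - y') ^ (2 * m)"
  shows False
proof -
  have nb: "\<forall>\<^sub>F r in nhds x. r \<in> {a<..<b}" using x by (intro eventually_nhds_in_open) auto
  have "\<forall>\<^sub>F r in nhds x. v x - n * (r - x) ^ (2 * m) \<le> v r"
    using nb
  proof eventually_elim
    case (elim r)
    then show ?case using min[of r x] x by auto
  qed
  then have fx: "f x \<le> 0"
    using x ab n by (intro radial_touching_critical[OF _ _ _ m, of x n]) auto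
  define D where "D t = n * (t - x) ^ (2 * m) - w t" for t
  have D: "(D has_real_derivative n * (real (2 * m) * (t - x) ^ (2 * m - 1)) - spow (1 / (q - 1)) (A t)) (at t)"
    if "a < t" "t < b" for t
    unfolding D_def by (auto intro!: derivative_eq_intros w that)
  have Dmin: "D x \<le> D t" if "a < t" "t < b" for t
    using min[of x t] that x m power_even_abs[of "2 * m" "x - t"] power_even_abs[of "2 * m" "t - x"]
    by (auto simp: D_def abs_minus_commute power_0_left)
  have "n * (real (2 * m) * (x - x) ^ (2 * m - 1)) - spow (1 / (q - 1)) (A x) = 0"
    by (rule DERIV_local_min[OF D[OF x], of "min (x - a) (b - x)"]) (use x Dmin in auto)
  then have Ax: "A x = 0" using m by (simp add: power_0_left)
  \<comment> \<open>Half of the lower bound \<epsilon>/\<kappa> for the derivative of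
    \<open>A\<close> at x, so that A (x + h) > c h for small h > 0.\<close>
  define c where "c = \<epsilon> / (2 * \<kappa>)"
  have c: "c > 0" using eps kappa_pos by (simp add: c_def)
  have "c < - ((f x - \<epsilon>) / \<kappa>)"
    using fx eps kappa_pos by (simp add: c_def divide_simps)
  moreover have "((\<lambda>h. (A (x + h) - A x) / h) \<longlongrightarrow> - ((f x - \<epsilon>) / \<kappa>)) (at 0)"
    using A[OF x] Ax unfolding DERIV_def by simp
  ultimately have "\<forall>\<^sub>F h in at 0. c < (A (x + h) - A x) / h"
    by (intro order_tendstoD)
  then have ev1: "\<forall>\<^sub>F h in at_right 0. c < A (x + h) / h"
    unfolding Ax by (auto simp: eventually_at_filter elim: eventually_mono)
  \<comment> \<open>Surplus of the exponent of the penalty slope over 1/(q-1), positive by the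
    choice of \<open>m\<close>.\<close>
  define e where "e = 2 * real m - 1 - 1 / (q - 1)"
  have e: "e > 0" using m(2) q by (simp add: e_def field_simps)
  have "((\<lambda>h. n * real (2 * m) * h powr e) \<longlongrightarrow> n * real (2 * m) * 0 powr e) (at_right 0)"
    by (intro tendsto_mult tendsto_const tendsto_powr' tendsto_ident_at)
      (use e in \<open>auto simp: eventually_at_filter\<close>)
  then have ev2: "\<forall>\<^sub>F h in at_right 0. n * real (2 * m) * h powr e < c powr (1 / (q - 1))"
    using c by (intro order_tendstoD(2)[where y = "n * real (2 * m) * 0 powr e"]) auto
  obtain \<delta> where \<delta>: "\<delta> > 0"
    "\<And>h. 0 < h \<Longrightarrow> h < \<delta> \<Longrightarrow> c < A (x + h) / h \<and> n * real (2 * m) * h powr e < c powr (1 / (q - 1))"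
    using eventually_conj[OF ev1 ev2] unfolding eventually_at_right_field by auto
  define y where "y = min (x + \<delta>) ((x + b) / 2)"
  have y: "x < y" "y < b" "y \<le> x + \<delta>" using \<delta>(1) x unfolding y_def min_def by auto
  \<comment> \<open>Minimality gives D x \<le> D y, so the mean value theorem yields a point z to
    the right of x where the penalty slope is at least w', against the growth rates.\<close>
  have "\<exists>z. x < z \<and> z < y \<and>
    D y - D x = (y - x) * (n * (real (2 * m) * (z - x) ^ (2 * m - 1)) - spow (1 / (q - 1)) (A z))"
    by (rule MVT2[OF y(1)]) (rule D, use x y in auto)
  then obtain z where z: "x < z" "z < y"
    "D y - D x = (y - x) * (n * (real (2 * m) * (z - x) ^ (2 * m - 1)) - spow (1 / (q - 1)) (A z))"
    by blast
  define h where "h = z - x"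
  have h: "0 < h" "h < \<delta>" "z = x + h" using z y by (auto simp: h_def)
  have "0 \<le> (y - x) * (n * (real (2 * m) * h ^ (2 * m - 1)) - spow (1 / (q - 1)) (A z))"
    using z(3) Dmin[of y] y x by (simp add: h_def)
  then have le: "spow (1 / (q - 1)) (A z) \<le> n * real (2 * m) * h ^ (2 * m - 1)"
    using y by (simp add: zero_le_mult_iff mult.assoc)
  have "c * h < A z" using \<delta>(2)[OF h(1,2)] h by (simp add: field_simps)
  then have "spow (1 / (q - 1)) (c * h) < spow (1 / (q - 1)) (A z)"
    using q by (intro spow_less) auto
  with le have "(c * h) powr (1 / (q - 1)) < n * real (2 * m) * h ^ (2 * m - 1)"
    using c h by (simp add: spow_pos)
  also have "h ^ (2 * m - 1) = h powr e * h powr (1 / (q - 1))"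
    using h m by (simp add: e_def powr_realpow[symmetric] of_nat_diff flip: powr_add)
  finally have "c powr (1 / (q - 1)) * h powr (1 / (q - 1)) < (n * real (2 * m) * h powr e) * h powr (1 / (q - 1))"
    using c h by (simp add: powr_mult mult.assoc)
  then have "c powr (1 / (q - 1)) < n * real (2 * m) * h powr e"
    using h by simp
  with \<delta>(2)[OF h(1,2)] show False by simp
qed

text \<open>Minimality in the second variable equates w' at y, up to sign, with the nonzero slope of
  the penalty, so \<open>A\<close> does not vanish near y. Moving both variables by the same amount
  leaves the penalty unchanged, so a translate of w touches v from below at x. It satisfies the
  equation at y but is tested at x; the mismatch is the difference of the values of \<open>f\<close>
  and of the coefficients 1/y and 1/x.\<close>

lemma doubled_min_interior:
  assumes m: "2 \<le> m" "(2 * real m - 1) * (q - 1) > 1"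
    and x: "a < x" "x < b" and y: "a < y" "y < b" and n: "n > 0"
    and min: "\<And>x' y'. x' \<in> {a..b} \<Longrightarrow> y' \<in> {a..b} \<Longrightarrow>
      v x - w y + n * (x - y) ^ (2 * m) \<le> v x' - w y' + n * (x' - y') ^ (2 * m)"
  shows "f x \<le> f y - \<epsilon> + (real CARD('n) - 1) * A y * (1 / y - 1 / x)"
proof (cases "x = y")
  case True
  then show ?thesis
    using doubled_min_diagonal[OF m x n] min m by (auto simp: power_0_left)
next
  case False
  define D where "D t = n * (x - t) ^ (2 * m) - w t" for t
  have D: "(D has_real_derivative n * (- real (2 * m) * (x - y) ^ (2 * m - 1)) - spow (1 / (q - 1)) (A y)) (at y)"
    unfolding D_def by (auto intro!: derivative_eq_intros w y)
  have "n * (- real (2 * m) * (x - y) ^ (2 * m - 1)) - spow (1 / (q - 1)) (A y) = 0"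
  proof (rule DERIV_local_min[OF D, of "min (y - a) (b - y)"])
    show "\<forall>t. \<bar>y - t\<bar> < min (y - a) (b - y) \<longrightarrow> D y \<le> D t"
    proof (intro allI impI)
      fix t assume "\<bar>y - t\<bar> < min (y - a) (b - y)"
      then show "D y \<le> D t" using min[of x t] x by (auto simp: D_def abs_less_iff)
    qed
  qed (use y in auto)
  then have Ay: "A y \<noteq> 0" using False n m by auto
  define h where "h = y - x"
  have Ac: "isCont A y" using A[OF y] by (rule DERIV_isCont)
  have "\<forall>\<^sub>F t in nhds y. A t \<noteq> 0"
    using tendsto_imp_eventually_ne[OF Ac[unfolded isCont_def] Ay] Ay
    by (simp add: eventually_nhds_conv_at)
  then obtain \<delta>0 where \<delta>0: "\<delta>0 > 0" "\<And>t. \<bar>t - y\<bar> < \<delta>0 \<Longrightarrow> A t \<noteq> 0"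
    unfolding eventually_nhds_metric dist_real_def by auto
  define \<delta> where "\<delta> = Min {\<delta>0, x - a, b - x, y - a, b - y}"
  have \<delta>: "\<delta> > 0" "\<delta> \<le> \<delta>0" "\<delta> \<le> x - a" "\<delta> \<le> b - x" "\<delta> \<le> y - a" "\<delta> \<le> b - y"
    using \<delta>0 x y by (auto simp: \<delta>_def)
  \<comment> \<open>The graph of w shifted by \<open>h = y - x\<close> and raised to meet v at x;
    comparing with the pairs (r, r + h), which all have the same penalty, gives g \<le> v.\<close>
  define g where "g r = w (r + h) + (v x - w y)" for r
  define A' where "A' t = (1 - d) * A t / t - (f t - \<epsilon>) / \<kappa>" for t
  define g1 where "g1 r = spow (1 / (q - 1)) (A (r + h))" for r
  define g2 where "g2 r = 1 / (q - 1) * \<bar>A (r + h)\<bar> powr (1 / (q - 1) - 1) * A' (r + h)" for r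
  have I: "a < r + h" "r + h < b" "A (r + h) \<noteq> 0" "a < r" "r < b" if "r \<in> {x - \<delta><..<x + \<delta>}" for r
    using that \<delta> \<delta>0(2)[of "r + h"] by (auto simp: h_def abs_less_iff)
  have "f x \<le> - (\<bar>g1 x\<bar> powr (q - 2)) * ((p - 1) * g2 x + (real CARD('n) - 1) * g1 x / x)"
  proof (rule radial_touching_noncritical[of "x - \<delta>" x "x + \<delta>" g])
    fix r assume r: "r \<in> {x - \<delta><..<x + \<delta>}"
    show "(g has_real_derivative g1 r) (at r)"
      unfolding g_def g1_def using w[OF I(1,2)[OF r]]
      by (auto intro!: derivative_eq_intros simp: DERIV_shift)
    have "((\<lambda>r. A (r + h)) has_real_derivative A' (r + h)) (at r)"
      using A[OF I(1,2)[OF r]] by (simp add: DERIV_shift A'_def)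
    from DERIV_chain2[OF DERIV_spow[OF I(3)[OF r], of "1 / (q - 1)"] this]
    show "(g1 has_real_derivative g2 r) (at r)"
      unfolding g1_def[abs_def] g2_def .
    show "g r \<le> v r"
      using min[of r "r + h"] I[OF r] by (auto simp: g_def h_def)
  next
    have "continuous_on {a<..<b} A"
      by (rule DERIV_continuous_on) (rule has_field_derivative_at_within[OF A], auto)
    then have "continuous_on {a<..<b} A'"
      unfolding A'_def using ab kappa_pos by (intro continuous_intros f_cont) auto
    have sub: "(\<lambda>r. r + h) ` {x - \<delta><..<x + \<delta>} \<subseteq> {a<..<b}" using I(1,2) by auto
    have c: "continuous_on {x - \<delta><..<x + \<delta>} (\<lambda>r. r + h)" by (intro continuous_intros)
    show "continuous_on {x - \<delta><..<x + \<delta>} g2"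
      unfolding g2_def
      by (intro continuous_intros continuous_on_compose2[OF \<open>continuous_on _ A\<close> c sub]
          continuous_on_compose2[OF \<open>continuous_on _ A'\<close> c sub]) (use I(3) in auto)
  qed (use \<delta> ab x y Ay in \<open>auto simp: g_def h_def g1_def\<close>)
  also have "\<dots> = - (p - 1) * (\<bar>g1 x\<bar> powr (q - 2) * g2 x) - (real CARD('n) - 1) / x * (\<bar>g1 x\<bar> powr (q - 2) * g1 x)"
    using x ab by (simp add: field_simps)
  also have "\<bar>g1 x\<bar> powr (q - 2) * g1 x = A y"
    using q by (simp add: g1_def h_def spow_powr_cancel)
  also have "\<bar>g1 x\<bar> powr (q - 2) * g2 x = (\<bar>g1 x\<bar> powr (q - 2) * \<bar>A y\<bar> powr (1 / (q - 1) - 1)) * A' y / (q - 1)"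
    by (simp add: g2_def h_def)
  also have "\<bar>g1 x\<bar> powr (q - 2) * \<bar>A y\<bar> powr (1 / (q - 1) - 1) = 1"
    using q Ay by (simp add: g1_def h_def spow_powr_cancel)
  also have "- (p - 1) * (1 * A' y / (q - 1)) = - \<kappa> * A' y"
    by (simp add: kappa diff_divide_distrib left_diff_distrib)
  also have "\<dots> = \<kappa> * (d - 1) * A y / y + f y - \<epsilon>"
    using kappa_pos y ab by (simp add: A'_def field_simps)
  finally show ?thesis
    unfolding kappa_dim by (simp add: algebra_simps diff_divide_distrib)
qed

text \<open>If v - w takes a negative value \<open>\<mu>\<close>, minimisers with growing penalty
  accumulate at a diagonal point (t, t) with v t - w t \<le> \<mu>. The boundary values keep t
  inside the interval, and the inequality for interior minimisers tends to f t \<le> f t -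
  \<epsilon>.\<close>

lemma comparison:
  assumes bd: "w a \<le> v a" "w b \<le> v b" and r: "r \<in> {a..b}"
  shows "w r \<le> v r"
proof (rule ccontr)
  assume neg: "\<not> w r \<le> v r"
  \<comment> \<open>A power high enough for (2m-1)(q-1) > 1, which both kinds of contact
    require.\<close>
  obtain m0 :: nat where m0: "real m0 > 1 / (q - 1) + 1" using reals_Archimedean2 by blast
  define m where "m = m0 + 2"
  have "1 / (q - 1) < 2 * real m - 1" using m0 q by (simp add: m_def)
  then have m: "2 \<le> m" "(2 * real m - 1) * (q - 1) > 1"
    using q by (simp_all add: m_def divide_simps)
  define \<mu> where "\<mu> = v r - w r"
  have mu: "\<mu> < 0" using neg by (simp add: \<mu>_def)
  define F where "F n z = v (fst z) - w (snd z) + real (Suc n) * (fst z - snd z) ^ (2 * m)" for n and z :: "real \<times> real"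
  let ?S = "{a..b} \<times> {a..b}"
  have lsc: "lower_semicontinuous_on ?S (F n)" for n
    unfolding lower_semicontinuous_on_def
  proof (intro ballI allI impI)
    fix z c assume z: "z \<in> ?S" "c < F n z"
    define \<eta> where "\<eta> = (F n z - c) / 2"
    define g where "g z = real (Suc n) * (fst z - snd z) ^ (2 * m) - w (snd z)" for z :: "real \<times> real"
    have "continuous_on ?S (\<lambda>z. w (snd z))"
      by (rule continuous_on_compose2[OF wc]) (auto intro!: continuous_intros)
    then have "continuous_on ?S g"
      unfolding g_def by (intro continuous_intros)
    then have "(g \<longlongrightarrow> g z) (at z within ?S)" using z(1) unfolding continuous_on_def by blast
    moreover have "g z - \<eta> < g z" using z by (simp add: \<eta>_def)
    ultimately have e1: "\<forall>\<^sub>F y in at z within ?S. g z - \<eta> < g y"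
      by (rule order_tendstoD)
    have fz: "0 \<le> fst z" "fst z < R" "v (fst z) - \<eta> < v (fst z)" using z ab by (auto simp: \<eta>_def)
    from v_lsc[OF this] obtain e where
      e: "e > 0" "\<And>s. 0 \<le> s \<Longrightarrow> s < R \<Longrightarrow> \<bar>s - fst z\<bar> < e \<Longrightarrow> v (fst z) - \<eta> < v s" by metis
    have "((\<lambda>y. fst y) \<longlongrightarrow> fst z) (at z within ?S)" by (intro tendsto_intros)
    then have e2: "\<forall>\<^sub>F y in at z within ?S. \<bar>fst y - fst z\<bar> < e"
      using tendstoD[OF _ e(1)] by (force simp: dist_real_def)
    have e3: "\<forall>\<^sub>F y in at z within ?S. y \<in> ?S"
      by (simp add: eventually_at_filter)
    show "\<forall>\<^sub>F y in at z within ?S. c < F n y"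
      using e1 e2 e3
    proof eventually_elim
      case (elim y)
      then have "v (fst z) - \<eta> < v (fst y)" using ab by (intro e(2)) auto
      with elim(1) show ?case by (simp add: F_def g_def \<eta>_def field_simps)
    qed
  qed
  have "\<exists>z\<in>?S. \<forall>z'\<in>?S. F n z \<le> F n z'" for n
  proof -
    have "compact ?S" "?S \<noteq> {}" using ab by (auto intro: compact_Times)
    then show ?thesis using lower_semicontinuous_attains_inf[OF _ _ lsc[of n]] by metis
  qed
  then obtain z where z: "\<And>n. z n \<in> ?S" "\<And>n z'. z' \<in> ?S \<Longrightarrow> F n (z n) \<le> F n z'" by metis
  have "compact ?S" by (auto intro: compact_Times)
  then obtain l \<sigma> where l: "l \<in> ?S" "strict_mono \<sigma>" "(z \<circ> \<sigma>) \<longlonglongrightarrow> l"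
    using z(1) unfolding compact_def by metis
  define X where "X n = fst (z (\<sigma> n))" for n
  define Y where "Y n = snd (z (\<sigma> n))" for n
  have X: "X \<longlonglongrightarrow> fst l" "\<And>n. X n \<in> {a..b}" and Y: "Y \<longlonglongrightarrow> snd l" "\<And>n. Y n \<in> {a..b}"
    using tendsto_fst[OF l(3)] tendsto_snd[OF l(3)] z(1) by (auto simp: X_def[abs_def] Y_def[abs_def] o_def mem_Times_iff)
  have Fmu: "v (X n) - w (Y n) + real (Suc (\<sigma> n)) * (X n - Y n) ^ (2 * m) \<le> \<mu>" for n
    using z(2)[of "(r, r)" "\<sigma> n"] r m by (simp add: F_def X_def Y_def \<mu>_def power_0_left)
  obtain B where B: "\<And>r. 0 \<le> r \<Longrightarrow> r < R \<Longrightarrow> \<bar>v r\<bar> \<le> B" using v_bounded by metis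
  obtain B' where B': "\<And>r. r \<in> {a..b} \<Longrightarrow> \<bar>w r\<bar> \<le> B'"
    using compact_imp_bounded[OF compact_continuous_image[OF wc compact_Icc]] unfolding bounded_iff by fastforce
  \<comment> \<open>Boundedness of v and w makes the 2m-th power of the distance O(1/n), so both
    components of the minimisers have the same limit.\<close>
  have "(X n - Y n) ^ (2 * m) \<le> (B + B') * inverse (real (Suc (\<sigma> n)))" for n
  proof -
    have "real (Suc (\<sigma> n)) * (X n - Y n) ^ (2 * m) \<le> B + B'"
      using Fmu[of n] mu B[of "X n"] B'[of "Y n"] X(2)[of n] Y(2)[of n] ab by auto
    then show ?thesis by (simp add: field_simps)
  qed
  moreover have "(\<lambda>n. (X n - Y n) ^ (2 * m)) \<longlonglongrightarrow> (fst l - snd l) ^ (2 * m)"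
    by (intro tendsto_intros X Y)
  moreover have "(\<lambda>n. (B + B') * inverse (real (Suc (\<sigma> n)))) \<longlonglongrightarrow> (B + B') * 0"
    by (intro tendsto_mult tendsto_const LIMSEQ_subseq_LIMSEQ[OF LIMSEQ_inverse_real_of_nat l(2), unfolded o_def])
  ultimately have "(fst l - snd l) ^ (2 * m) \<le> 0"
    using LIMSEQ_le by fastforce
  then have eq: "fst l = snd l"
    using zero_less_power_eq[of "fst l - snd l" "2 * m"] by fastforce
  define t where "t = snd l"
  have t: "X \<longlonglongrightarrow> t" "Y \<longlonglongrightarrow> t" "t \<in> {a..b}" using X Y eq l(1) by (auto simp: t_def mem_Times_iff)
  have wY: "(\<lambda>n. w (Y n)) \<longlonglongrightarrow> w t"
    using wc t(2,3) by (rule continuous_on_tendsto_compose) (use Y(2) in auto)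
  \<comment> \<open>The penalty is dropped, being nonnegative. Lower semicontinuity suffices because
    v appears on the smaller side.\<close>
  have "v t \<le> \<mu> + w t"
  proof (rule v_le_lim[OF _ _ _ _ t(1)])
    show "(\<lambda>n. \<mu> + w (Y n)) \<longlonglongrightarrow> \<mu> + w t" by (intro tendsto_intros wY)
    show "v (X n) \<le> \<mu> + w (Y n)" for n
    proof -
      have "0 \<le> real (Suc (\<sigma> n)) * (X n - Y n) ^ (2 * m)" by simp
      with Fmu[of n] show ?thesis by linarith
    qed
  qed (use X(2) t(3) ab in \<open>auto intro: less_le_trans[of 0 a] le_less_trans[of _ b R] order_trans[of 0 a]\<close>)
  then have tab: "a < t" "t < b" using mu bd t(3) by (auto simp: less_le)
  have ev: "\<forall>\<^sub>F n in sequentially. f (X n) \<le> f (Y n) - \<epsilon> + (real CARD('n) - 1) * A (Y n) * (1 / Y n - 1 / X n)"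
    using order_tendstoD(1)[OF t(1) tab(1)] order_tendstoD(2)[OF t(1) tab(2)]
      order_tendstoD(1)[OF t(2) tab(1)] order_tendstoD(2)[OF t(2) tab(2)]
  proof eventually_elim
    case (elim n)
    show ?case
      by (rule doubled_min_interior[OF m elim, of "real (Suc (\<sigma> n))"])
        (use z(2)[of _ "\<sigma> n"] in \<open>auto simp: F_def X_def Y_def\<close>)
  qed
  have fc: "isCont f t" "isCont A t"
    using f_cont tab continuous_on_eq_continuous_at[of "{a<..<b}" f] DERIV_isCont[OF A[OF tab]] by auto
  have lims: "(\<lambda>n. f (X n)) \<longlonglongrightarrow> f t" "(\<lambda>n. f (Y n)) \<longlonglongrightarrow> f t" "(\<lambda>n. A (Y n)) \<longlonglongrightarrow> A t"
    using isCont_tendsto_compose fc t by blast+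
  have "(\<lambda>n. f (Y n) - \<epsilon> + (real CARD('n) - 1) * A (Y n) * (1 / Y n - 1 / X n)) \<longlonglongrightarrow>
      f t - \<epsilon> + (real CARD('n) - 1) * A t * (1 / t - 1 / t)"
    using tab ab by (intro tendsto_intros lims t) auto
  from tendsto_le[OF _ this lims(1) ev] show False using eps by simp
qed

end

section \<open>Generalised concavity\<close>

text \<open>\<open>H\<close> plays the role of the slope field: \<open>w' = H C\<close> for the curves that replace the affine functions
  in the definition of concavity.\<close>

locale generalized_concave =
  fixes H :: "real \<Rightarrow> real \<Rightarrow> real" and v :: "real \<Rightarrow> real" and \<alpha> \<beta> :: real
  assumes H_cont: "continuous_on (UNIV \<times> {\<alpha><..<\<beta>}) (\<lambda>(C, r). H C r)"
    and H_less: "\<And>C C' r. \<alpha> < r \<Longrightarrow> r < \<beta> \<Longrightarrow> C < C' \<Longrightarrow> H C r < H C' r"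
    and H_above: "\<And>a b K. \<alpha> < a \<Longrightarrow> a < b \<Longrightarrow> b < \<beta> \<Longrightarrow> \<exists>C. \<forall>r\<in>{a..b}. K \<le> H C r"
    and H_below: "\<And>a b K. \<alpha> < a \<Longrightarrow> a < b \<Longrightarrow> b < \<beta> \<Longrightarrow> \<exists>C. \<forall>r\<in>{a..b}. H C r \<le> K"
    and concave: "\<And>a m b C. \<alpha> < a \<Longrightarrow> a < m \<Longrightarrow> m < b \<Longrightarrow> b < \<beta> \<Longrightarrow>
      v b - v a = integral {a..b} (H C) \<Longrightarrow> integral {a..m} (H C) \<le> v m - v a"
begin

lemma H_cont_r: "\<alpha> < a \<Longrightarrow> b < \<beta> \<Longrightarrow> continuous_on {a..b} (H C)"
  using continuous_on_compose2[OF H_cont, of "{a..b}" "\<lambda>r. (C, r)"]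
  by (force intro!: continuous_on_Pair continuous_on_const continuous_on_id)

lemma H_integrable: "\<alpha> < a \<Longrightarrow> b < \<beta> \<Longrightarrow> H C integrable_on {a..b}"
  using H_cont_r integrable_continuous_real by blast

lemma integral_H_less_iff:
  assumes "\<alpha> < a" "a < b" "b < \<beta>"
  shows "integral {a..b} (H C) < integral {a..b} (H C') \<longleftrightarrow> C < C'"
proof -
  have *: "integral {a..b} (H C) < integral {a..b} (H C')" if "C < C'" for C C'
  proof (rule integral_less_real[OF H_cont_r H_cont_r])
    show "{a<..<b} \<noteq> {}" using assms by simp
  qed (use assms that H_less in auto)
  show ?thesis
    using *[of C C'] *[of C' C] by (cases C C' rule: linorder_cases) auto
qed

text \<open>The mean slope \<open>K\<close> lies between two members of the slope field, one below
  and one above it on the whole interval; the intermediate value theorem in C does the rest.\<close>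

lemma chord_ex:
  assumes "\<alpha> < a" "a < b" "b < \<beta>"
  shows "\<exists>C. v b - v a = integral {a..b} (H C)"
proof -
  define K where "K = (v b - v a) / (b - a)"
  have K: "integral {a..b} (\<lambda>r. K) = v b - v a" using assms by (simp add: K_def)
  obtain C1 where C1: "\<And>r. r \<in> {a..b} \<Longrightarrow> H C1 r \<le> K" using H_below[OF assms] by metis
  obtain C2 where C2: "\<And>r. r \<in> {a..b} \<Longrightarrow> K \<le> H C2 r" using H_above[OF assms] by metis
  have 1: "integral {a..b} (H C1) \<le> v b - v a"
    unfolding K[symmetric] using assms C1 by (intro integral_le H_integrable) auto
  have 2: "v b - v a \<le> integral {a..b} (H C2)"
    unfolding K[symmetric] using assms C2 by (intro integral_le H_integrable) auto
  have "C1 \<le> C2"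
    using 1 2 integral_H_less_iff[OF assms, of C2 C1] by linarith
  moreover have "continuous_on UNIV (\<lambda>C. integral (cbox a b) (H C))"
    by (rule integral_continuous_on_param)
      (rule continuous_on_subset[OF H_cont], use assms in auto)
  then have "continuous_on {C1..C2} (\<lambda>C. integral {a..b} (H C))"
    by (auto intro: continuous_on_subset)
  ultimately show ?thesis
    using IVT'[of "\<lambda>C. integral {a..b} (H C)" C1 "v b - v a" C2] 1 2 by metis
qed

text \<open>Generalised slope: the parameter of the curve of the family through the two points of
  the graph of v. It is unique because the integral is strictly increasing in C.\<close>

definition chord :: "real \<Rightarrow> real \<Rightarrow> real" where
  "chord a b = (SOME C. v b - v a = integral {a..b} (H C))"

lemma chord: "\<alpha> < a \<Longrightarrow> a < b \<Longrightarrow> b < \<beta> \<Longrightarrow> v b - v a = integral {a..b} (H (chord a b))"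
  unfolding chord_def by (rule someI_ex[OF chord_ex])

text \<open>By concavity the long curve passes below the graph at m. It therefore rises too little
  before m and too much after it, and strict monotonicity in C translates this into an order of
  parameters.\<close>

lemma chord_mono:
  assumes "\<alpha> < a" "a < m" "m < b" "b < \<beta>"
  shows "chord a b \<le> chord a m" "chord m b \<le> chord a b"
proof -
  have c: "v b - v a = integral {a..b} (H (chord a b))" using assms by (intro chord) auto
  have 1: "integral {a..m} (H (chord a b)) \<le> v m - v a"
    by (rule concave[OF assms c])
  then show "chord a b \<le> chord a m"
    using chord[of a m] integral_H_less_iff[of a m "chord a m" "chord a b"] assms by force
  have "integral {a..m} (H (chord a b)) + integral {m..b} (H (chord a b)) = integral {a..b} (H (chord a b))"
    using assms by (intro Henstock_Kurzweil_Integration.integral_combine H_integrable) auto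
  then have "v b - v m \<le> integral {m..b} (H (chord a b))" using 1 c by linarith
  then show "chord m b \<le> chord a b"
    using chord[of m b] integral_H_less_iff[of m b "chord a b" "chord m b"] assms by force
qed

text \<open>Counterpart of the right derivative of a concave function: chords from a increase as b
  decreases to a, so the supremum is their limit. It is finite at interior points, since a chord
  ending at a bounds all chords that start there.\<close>

definition flux :: "real \<Rightarrow> real" where
  "flux a = (SUP b\<in>{a<..<\<beta>}. chord a b)"

lemma flux_bounds:
  assumes "\<alpha> < a" "a < b" "b < \<beta>"
  shows "flux b \<le> chord a b" "chord a b \<le> flux a"
proof -
  have le: "chord s t \<le> chord r s" if "\<alpha> < r" "r < s" "s < t" "t < \<beta>" for r s t
    using chord_mono[of r s t] that by linarith
  show "flux b \<le> chord a b"
    unfolding flux_def using assms le by (intro cSUP_least) auto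
  obtain a' where "\<alpha> < a'" "a' < a" using assms dense by blast
  then have "bdd_above (chord a ` {a<..<\<beta>})" using le assms by (intro bdd_aboveI2[of _ _ "chord a' a"]) auto
  then show "chord a b \<le> flux a"
    unfolding flux_def using assms by (intro cSUP_upper) auto
qed

lemma flux_antimono: "\<alpha> < a \<Longrightarrow> a \<le> b \<Longrightarrow> b < \<beta> \<Longrightarrow> flux b \<le> flux a"
  using flux_bounds[of a b] by (cases "a = b") auto

text \<open>Since v is not known to be differentiable, the mean value theorem is applied to the
  curve through the two points of its graph; the parameter of this curve lies between the two
  fluxes.\<close>

lemma mean_value:
  assumes "\<alpha> < a" "a < b" "b < \<beta>"
  obtains C s where "flux b \<le> C" "C \<le> flux a" "a < s" "s < b" "v b - v a = (b - a) * H C s"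
proof -
  define I where "I t = integral {a..t} (H (chord a b))" for t
  have c: "continuous_on {a..b} (H (chord a b))" using assms H_cont_r by simp
  have I: "(I has_real_derivative H (chord a b) t) (at t within {a..b})" if "t \<in> {a..b}" for t
    unfolding I_def using c that by (rule integral_has_real_derivative)
  have "\<exists>t. a < t \<and> t < b \<and> I b - I a = (b - a) * H (chord a b) t"
  proof -
    have "\<exists>t\<in>{a<..<b}. I b - I a = H (chord a b) t * (b - a)"
      by (rule mvt_simple[OF assms(2)]) (use I in \<open>auto simp: has_field_derivative_def\<close>)
    then show ?thesis by (auto simp: mult.commute)
  qed
  moreover have "I b - I a = v b - v a" using chord[OF assms] by (simp add: I_def)
  ultimately show thesis using that flux_bounds[OF assms] by metis
qed

text \<open>Around r all chord parameters stay in the compact interval from \<open>flux b\<close> to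
  \<open>flux a\<close>, on which the slope field is bounded. By the mean value property v is
  locally Lipschitz.\<close>

lemma continuous: "continuous_on {\<alpha><..<\<beta>} v"
proof (intro continuous_at_imp_continuous_on ballI)
  fix r assume r: "r \<in> {\<alpha><..<\<beta>}"
  obtain a b where ab: "\<alpha> < a" "a < r" "r < b" "b < \<beta>"
    using r dense[of \<alpha> r] dense[of r \<beta>] by auto
  have "compact ((\<lambda>(C, r). H C r) ` ({flux b..flux a} \<times> {a..b}))"
    by (intro compact_continuous_image continuous_on_subset[OF H_cont] compact_Times) (use ab in auto)
  then obtain K where K: "\<And>C s. C \<in> {flux b..flux a} \<Longrightarrow> s \<in> {a..b} \<Longrightarrow> \<bar>H C s\<bar> \<le> K"
    unfolding compact_eq_bounded_closed bounded_iff by fastforce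
  have lip: "\<bar>v y - v x\<bar> \<le> K * (y - x)" if "a < x" "x < y" "y < b" for x y
  proof -
    have xy: "\<alpha> < x" "x < y" "y < \<beta>" using that ab by auto
    obtain C s where Cs: "flux y \<le> C" "C \<le> flux x" "x < s" "s < y" "v y - v x = (y - x) * H C s"
      by (rule mean_value[OF xy])
    have "flux b \<le> flux y" "flux x \<le> flux a" using that ab by (auto intro!: flux_antimono)
    then have "\<bar>H C s\<bar> \<le> K" using Cs that by (intro K) auto
    then show ?thesis using that by (simp add: Cs abs_mult mult.commute)
  qed
  have "\<forall>\<^sub>F s in at r. s \<in> {a<..<b}" using ab by (intro eventually_at_in_open') auto
  then have ev: "\<forall>\<^sub>F s in at r. norm (v s - v r) \<le> K * \<bar>s - r\<bar>"
    using eventually_neq_at_within[of r r]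
  proof eventually_elim
    case (elim s)
    then show ?case using lip[of r s] lip[of s r] ab by (cases "s < r") (auto simp: abs_minus_commute)
  qed
  have "((\<lambda>s. K * \<bar>s - r\<bar>) \<longlongrightarrow> K * \<bar>r - r\<bar>) (at r)"
    by (intro tendsto_mult tendsto_const tendsto_rabs tendsto_diff tendsto_ident_at)
  then have "((\<lambda>s. v s - v r) \<longlongrightarrow> 0) (at r)"
    by (intro Lim_null_comparison[OF ev]) simp
  then show "isCont v r" unfolding isCont_def by (simp add: LIM_zero_iff)
qed

text \<open>Every difference quotient at r is \<open>H C t\<close> with C between the fluxes at its
  end points and t between these points. Continuity of the flux at r and joint continuity of
  \<open>H\<close> finish the argument.\<close>

lemma has_derivative_flux:
  assumes r: "\<alpha> < r" "r < \<beta>" and F: "isCont flux r"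
  shows "(v has_real_derivative H (flux r) r) (at r)"
  unfolding has_field_derivative_iff
proof (rule tendstoI)
  fix e :: real assume e: "e > 0"
  have "open (UNIV \<times> {\<alpha><..<\<beta>})" by (intro open_Times) auto
  then have "isCont (\<lambda>(C, r). H C r) (flux r, r)"
    using H_cont r continuous_on_eq_continuous_at by (metis SigmaI UNIV_I greaterThanLessThan_iff)
  then obtain \<delta> where \<delta>: "\<delta> > 0" "\<And>z. dist z (flux r, r) < \<delta> \<Longrightarrow> dist (H (fst z) (snd z)) (H (flux r) r) < e"
    using e unfolding continuous_at_eps_delta by (auto simp: case_prod_unfold)
  have \<delta>': "dist (H C s) (H (flux r) r) < e" if "\<bar>C - flux r\<bar> < \<delta> / 2" "\<bar>s - r\<bar> < \<delta> / 2" for C s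
  proof -
    have "dist (C, s) (flux r, r) \<le> \<bar>C - flux r\<bar> + \<bar>s - r\<bar>"
      unfolding dist_Pair_Pair dist_real_def by (rule sqrt_sum_squares_le_sum_abs[THEN order_trans]) simp
    then show ?thesis using \<delta>(2)[of "(C, s)"] that by simp
  qed
  have "(flux \<longlongrightarrow> flux r) (at r)" using F by (simp add: isCont_def)
  from tendstoD[OF this, of "\<delta> / 2"] have "\<forall>\<^sub>F s in at r. \<bar>flux s - flux r\<bar> < \<delta> / 2"
    using \<delta>(1) by (simp add: dist_real_def)
  moreover from tendstoD[OF tendsto_ident_at[of r UNIV], of "\<delta> / 2"]
  have "\<forall>\<^sub>F s in at r. \<bar>s - r\<bar> < \<delta> / 2" using \<delta>(1) by (simp add: dist_real_def)
  moreover have "\<forall>\<^sub>F s in at r. s \<in> {\<alpha><..<\<beta>}" using r by (intro eventually_at_in_open') auto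
  moreover have "\<forall>\<^sub>F s in at r. s \<noteq> r" by (rule eventually_neq_at_within)
  ultimately show "\<forall>\<^sub>F s in at r. dist ((v s - v r) / (s - r)) (H (flux r) r) < e"
  proof eventually_elim
    case (elim s)
    show ?case
    proof (cases "s < r")
      case True
      obtain C t where "flux r \<le> C" "C \<le> flux s" "s < t" "t < r" "v r - v s = (r - s) * H C t"
        using mean_value[of s r] True elim r by auto
      moreover from this have "(v s - v r) / (s - r) = H C t" using True by (simp add: field_simps)
      ultimately show ?thesis using elim by (auto intro!: \<delta>')
    next
      case False
      then have "r < s" using elim by simp
      obtain C t where "flux s \<le> C" "C \<le> flux r" "r < t" "t < s" "v s - v r = (s - r) * H C t"
        using mean_value[of r s] \<open>r < s\<close> elim r by auto
      moreover from this have "(v s - v r) / (s - r) = H C t" using \<open>r < s\<close> by (simp add: field_simps)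
      ultimately show ?thesis using elim by (auto intro!: \<delta>')
    qed
  qed
qed

lemma countable_exceptions:
  "countable {r \<in> {\<alpha><..<\<beta>}. \<not> isCont flux r}"
proof -
  have "mono_on {\<alpha><..<\<beta>} (\<lambda>r. - flux r)" by (rule mono_onI) (auto intro: flux_antimono)
  then have "countable {r \<in> {\<alpha><..<\<beta>}. \<not> isCont (\<lambda>r. - flux r) r}"
    by (intro mono_on_ctble_discont_open) auto
  then show ?thesis by (rule countable_subset[rotated]) (auto dest: continuous_minus)
qed

end

section \<open>The slope field of the radial equation\<close>

context radial_setting
begin

definition G :: "real \<Rightarrow> real" where
  "G r = integral {0..r} (\<lambda>s. f s * s powr (d - 1)) / \<kappa>"

lemma weighted_f_cont: "T < R \<Longrightarrow> continuous_on {0..T} (\<lambda>s. f s * s powr (d - 1))"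
  using d_gt_1 
  by (intro continuous_on_mult continuous_on_powr' continuous_on_subset[OF contf] continuous_intros) auto

lemma G_0 [simp]: "G 0 = 0" by (simp add: G_def)

lemma G_within:
  assumes "0 \<le> r" "r \<le> T" "T < R"
  shows "(G has_real_derivative f r * r powr (d - 1) / \<kappa>) (at r within {0..T})"
  using integral_has_real_derivative[OF weighted_f_cont[OF assms(3)], of r] assms
  unfolding G_def[abs_def] by (intro DERIV_cdivide) auto

lemma G_deriv:
  assumes "0 < r" "r < R"
  shows "(G has_real_derivative f r * r powr (d - 1) / \<kappa>) (at r)"
proof -
  obtain T where T: "r < T" "T < R" using assms dense by blast
  then have "(G has_real_derivative f r * r powr (d - 1) / \<kappa>) (at r within {0<..<T})"
    using assms by (intro DERIV_subset[OF G_within[of r T]]) auto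
  then show ?thesis using assms T by (simp add: at_within_open[of r "{0<..<T}"])
qed

lemma G_cont: "T < R \<Longrightarrow> continuous_on {0..T} G"
  by (rule DERIV_continuous_on[OF G_within]) auto

text \<open>Explicit solution of the equation for A with right side f - \<epsilon>: r^(d-1) A is C
  minus a primitive of (f - \<epsilon>) r^(d-1)/\<kappa>, and \<epsilon> r^d/(\<kappa> d) is the
  part of it due to \<epsilon>.\<close>

definition field_arg :: "real \<Rightarrow> real \<Rightarrow> real \<Rightarrow> real" where
  "field_arg \<epsilon> C r = (C - G r + \<epsilon> * r powr d / (\<kappa> * d)) * r powr (1 - d)"

lemma field_arg_deriv:
  assumes "0 < r" "r < R"
  shows "(field_arg \<epsilon> C has_real_derivative
    (1 - d) * field_arg \<epsilon> C r / r - (f r - \<epsilon>) / \<kappa>) (at r)"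
proof -
  have pw: "r powr (d - 1) * r powr (1 - d) = 1" "r powr (- d) = r powr (1 - d) / r"
    using assms by (simp_all add: powr_add[symmetric] powr_diff powr_minus field_simps)
  define X where "X = C - G r + \<epsilon> * r powr d / (\<kappa> * d)"
  have 1: "((\<lambda>r. (C - G r + \<epsilon> * r powr d / (\<kappa> * d)) * r powr (1 - d)) has_real_derivative
    (- (f r * r powr (d - 1) / \<kappa>) + \<epsilon> * (d * r powr (d - 1)) / (\<kappa> * d)) * r powr (1 - d)
     + (C - G r + \<epsilon> * r powr d / (\<kappa> * d)) * ((1 - d) * r powr (- d))) (at r)"
    using assms kappa_pos d_gt_1 by (auto intro!: derivative_eq_intros G_deriv)
  have 2: "(- (f r * r powr (d - 1) / \<kappa>) + \<epsilon> * (d * r powr (d - 1)) / (\<kappa> * d)) * r powr (1 - d)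
      = - ((f r - \<epsilon>) / \<kappa>) * (r powr (d - 1) * r powr (1 - d))"
    using kappa_pos d_gt_1 by (simp add: field_simps)
  have 3: "X * ((1 - d) * r powr (- d)) = (1 - d) * (X * r powr (1 - d)) / r"
    by (simp add: pw(2))
  show ?thesis
    unfolding field_arg_def[abs_def]
    using 1 unfolding 2 X_def[symmetric] 3 pw(1) by simp
qed

text \<open>Concavity is the comparison principle: the curve that agrees with v at both end points
  is a strict subsolution, hence lies below v in between.\<close>

lemma generalized_concave_v:
  assumes eps: "\<epsilon> > 0"
  shows "generalized_concave (\<lambda>C r. spow (1 / (q - 1)) (field_arg \<epsilon> C r)) v 0 R"
proof
  have q': "1 / (q - 1) > 0" using q by simp
  have Gc: "continuous_on {0<..<R} G"
    by (intro continuous_at_imp_continuous_on ballI DERIV_isCont[OF G_deriv]) auto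
  have "continuous_on (UNIV \<times> {0<..<R}) (\<lambda>z::real \<times> real. G (snd z))"
    by (rule continuous_on_compose2[OF Gc continuous_on_snd[OF continuous_on_id]]) auto
  then have "continuous_on (UNIV \<times> {0<..<R}) (\<lambda>z. field_arg \<epsilon> (fst z) (snd z))"
    unfolding field_arg_def using kappa_pos d_gt_1
    by (intro continuous_on_mult continuous_on_add continuous_on_diff continuous_on_divide
        continuous_on_powr continuous_on_fst continuous_on_snd continuous_on_id continuous_on_const) auto
  from continuous_on_compose2[OF continuous_spow[OF q'] this]
  show "continuous_on (UNIV \<times> {0<..<R}) (\<lambda>(C, r). spow (1 / (q - 1)) (field_arg \<epsilon> C r))"
    by (simp add: case_prod_unfold)
  show "spow (1 / (q - 1)) (field_arg \<epsilon> C r) < spow (1 / (q - 1)) (field_arg \<epsilon> C' r)"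
    if "0 < r" "r < R" "C < C'" for C C' r
    by (rule spow_less[OF q']) (use that in \<open>simp add: field_arg_def\<close>)
  have bound: "\<exists>C. \<forall>r\<in>{a..b}. \<bar>K\<bar> \<le> spow (1 / (q - 1)) (field_arg \<epsilon> C r)"
    "\<exists>C. \<forall>r\<in>{a..b}. spow (1 / (q - 1)) (field_arg \<epsilon> C r) \<le> - \<bar>K\<bar>" 
    if ab: "0 < a" "a < b" "b < R" for a b K
  proof -
    \<comment> \<open>The flux of slope |K|. To reach it on the whole interval, C has to dominate
      \<open>g\<close> and the weighted flux, whose bounds are \<open>B1\<close> and
      \<open>B2\<close>.\<close>
    define K' where "K' = \<bar>K\<bar> powr (q - 1)"
    have K': "spow (1 / (q - 1)) K' = \<bar>K\<bar>" using q by (simp add: K'_def spow_pos powr_powr)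
    define g where "g r = G r - \<epsilon> * r powr d / (\<kappa> * d)" for r
    have "continuous_on {a..b} g" "continuous_on {a..b} (\<lambda>r. K' * r powr (d - 1))"
      unfolding g_def using ab kappa_pos d_gt_1
      by (auto intro!: continuous_intros continuous_on_subset[OF Gc])
    then have "bounded (g ` {a..b})" "bounded ((\<lambda>r. K' * r powr (d - 1)) ` {a..b})"
      by (auto intro!: compact_imp_bounded compact_continuous_image)
    then obtain B1 B2 where B: "\<And>r. r \<in> {a..b} \<Longrightarrow> \<bar>g r\<bar> \<le> B1" "\<And>r. r \<in> {a..b} \<Longrightarrow> \<bar>K' * r powr (d - 1)\<bar> \<le> B2"
      unfolding bounded_iff by fastforce
    have *: "K' \<le> field_arg \<epsilon> (B1 + B2) r" "field_arg \<epsilon> (- (B1 + B2)) r \<le> - K'" if "r \<in> {a..b}" for r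
    proof -
      have r: "r > 0" using that ab by simp
      have pw: "(K' * r powr (d - 1)) * r powr (1 - d) = K'" using r by (simp add: powr_add[symmetric])
      have fa: "field_arg \<epsilon> C r = (C - g r) * r powr (1 - d)" for C
        by (simp add: field_arg_def g_def)
      have B': "K' * r powr (d - 1) \<le> B1 + B2 - g r" "- (B1 + B2) - g r \<le> - (K' * r powr (d - 1))"
        using B[OF that] by linarith+
      show "K' \<le> field_arg \<epsilon> (B1 + B2) r" "field_arg \<epsilon> (- (B1 + B2)) r \<le> - K'"
        using mult_right_mono[OF B'(1), of "r powr (1 - d)"] mult_right_mono[OF B'(2), of "r powr (1 - d)"]
        unfolding fa mult_minus_left pw by simp_all
    qed
    show "\<exists>C. \<forall>r\<in>{a..b}. \<bar>K\<bar> \<le> spow (1 / (q - 1)) (field_arg \<epsilon> C r)"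
      using spow_mono[OF q' *(1)] unfolding K' by blast
    show "\<exists>C. \<forall>r\<in>{a..b}. spow (1 / (q - 1)) (field_arg \<epsilon> C r) \<le> - \<bar>K\<bar>"
      using spow_mono[OF q' *(2)] unfolding spow_minus K' by blast
  qed
  show "\<exists>C. \<forall>r\<in>{a..b}. K \<le> spow (1 / (q - 1)) (field_arg \<epsilon> C r)"
    "\<exists>C. \<forall>r\<in>{a..b}. spow (1 / (q - 1)) (field_arg \<epsilon> C r) \<le> K"
    if ab: "0 < a" "a < b" "b < R" for a b K
  proof -
    show "\<exists>C. \<forall>r\<in>{a..b}. K \<le> spow (1 / (q - 1)) (field_arg \<epsilon> C r)"
      using bound(1)[OF ab, of K] by (meson abs_ge_self order_trans)
    show "\<exists>C. \<forall>r\<in>{a..b}. spow (1 / (q - 1)) (field_arg \<epsilon> C r) \<le> K"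
      using bound(2)[OF ab, of K] abs_ge_minus_self[of K] by (meson order_trans minus_le_iff)
  qed
  fix a m b C
  assume ab: "0 < a" "a < m" "m < b" "b < R"
    and eq: "v b - v a = integral {a..b} (\<lambda>r. spow (1 / (q - 1)) (field_arg \<epsilon> C r))"
  define w where "w r = v a + integral {a..r} (\<lambda>r. spow (1 / (q - 1)) (field_arg \<epsilon> C r))" for r
  have "continuous_on {a..b} (field_arg \<epsilon> C)"
    by (rule DERIV_continuous_on) (rule has_field_derivative_at_within[OF field_arg_deriv], use ab in auto)
  then have c: "continuous_on {a..b} (\<lambda>r. spow (1 / (q - 1)) (field_arg \<epsilon> C r))"
    by (rule continuous_on_compose2[OF continuous_spow[OF q']]) auto
  have w: "(w has_real_derivative spow (1 / (q - 1)) (field_arg \<epsilon> C r)) (at r within {a..b})" if "r \<in> {a..b}" for r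
    unfolding w_def using integral_has_real_derivative[OF c that]
    by (auto intro!: derivative_eq_intros)
  note amb = ab
  interpret strict_subsolution p q R f u k \<kappa> d a b \<epsilon> "field_arg \<epsilon> C" w
  proof
    fix r assume r: "a < r" "r < b"
    show "(field_arg \<epsilon> C has_real_derivative (1 - d) * field_arg \<epsilon> C r / r - (f r - \<epsilon>) / \<kappa>) (at r)"
      using r ab by (intro field_arg_deriv) auto
    show "(w has_real_derivative spow (1 / (q - 1)) (field_arg \<epsilon> C r)) (at r)"
      using w[of r] r by (simp add: at_within_Icc_at)
  next
    show "continuous_on {a..b} w" by (rule DERIV_continuous_on[OF w])
  qed (use ab eps in auto)
  have "w m \<le> v m"
    by (rule comparison) (use amb eq in \<open>auto simp: w_def\<close>)
  then show "integral {a..m} (\<lambda>r. spow (1 / (q - 1)) (field_arg \<epsilon> C r)) \<le> v m - v a"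
    by (simp add: w_def)
qed

text \<open>Each \<epsilon> = 1/(n+1) yields its own flux \<open>F n\<close>. As v has only one
  derivative and \<open>spow\<close> is injective, \<open>F n\<close> plus its \<epsilon>-correction
  is the same function \<open>M0\<close> for all n off \<open>E\<close>. The correction tends to 0
  pointwise, so the monotonicity of all \<open>F n\<close> passes to \<open>M0\<close>.\<close>

lemma ex_monotone_flux:
  obtains E M0 where "countable E" "continuous_on {0<..<R} v"
    "\<And>r. r \<in> {0<..<R} - E \<Longrightarrow> (v has_real_derivative spow (1 / (q - 1)) ((M0 r - G r) * r powr (1 - d))) (at r)"
    "\<And>r s. r \<in> {0<..<R} - E \<Longrightarrow> s \<in> {0<..<R} - E \<Longrightarrow> r \<le> s \<Longrightarrow> M0 s \<le> M0 r"
proof -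
  have q': "1 / (q - 1) > 0" using q by simp
  define \<epsilon> where "\<epsilon> n = inverse (real (Suc n))" for n
  define H where "H n C r = spow (1 / (q - 1)) (field_arg (\<epsilon> n) C r)" for n C r
  have gc: "generalized_concave (H n) v 0 R" for n
    unfolding H_def by (rule generalized_concave_v) (simp add: \<epsilon>_def)
  define F where "F n = generalized_concave.flux (H n) v R" for n
  define E where "E = (\<Union>n. {r \<in> {0<..<R}. \<not> isCont (F n) r})"
  define M0 where "M0 r = F 0 r + \<epsilon> 0 * r powr d / (\<kappa> * d)" for r
  have E: "countable E"
    unfolding E_def F_def using generalized_concave.countable_exceptions[OF gc] by (intro countable_UN) auto
  have D: "(v has_real_derivative H n (F n r) r) (at r)" if "r \<in> {0<..<R} - E" for n r
    using generalized_concave.has_derivative_flux[OF gc, of r n] that unfolding F_def E_def by auto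
  have M0: "F n r + \<epsilon> n * r powr d / (\<kappa> * d) = M0 r" if r: "r \<in> {0<..<R} - E" for n r
  proof -
    have "H n (F n r) r = H 0 (F 0 r) r" using D[OF r] DERIV_unique by blast
    then have "field_arg (\<epsilon> n) (F n r) r = field_arg (\<epsilon> 0) (F 0 r) r"
      unfolding H_def using spow_less[OF q'] by (metis less_irrefl linorder_neqE)
    then show ?thesis using r by (auto simp: field_arg_def M0_def)
  qed
  show thesis
  proof (rule that[OF E])
    show "continuous_on {0<..<R} v" by (rule generalized_concave.continuous[OF gc])
    show "(v has_real_derivative spow (1 / (q - 1)) ((M0 r - G r) * r powr (1 - d))) (at r)"
      if "r \<in> {0<..<R} - E" for r
      using D[OF that, of 0] by (simp add: H_def field_arg_def M0_def algebra_simps)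
    show "M0 s \<le> M0 r" if r: "r \<in> {0<..<R} - E" and s: "s \<in> {0<..<R} - E" and rs: "r \<le> s" for r s
    proof -
      have Fm: "F n s \<le> F n r" for n
        unfolding F_def using generalized_concave.flux_antimono[OF gc, of r s n] r s rs by auto
      have le: "M0 s - \<epsilon> n * (s powr d / (\<kappa> * d)) \<le> M0 r - \<epsilon> n * (r powr d / (\<kappa> * d))" for n
        using Fm[of n] M0[OF r, of n] M0[OF s, of n] unfolding times_divide_eq_right by linarith
      have lim: "(\<lambda>n. M0 s - \<epsilon> n * (s powr d / (\<kappa> * d))) \<longlonglongrightarrow> M0 s - 0 * (s powr d / (\<kappa> * d))"
        "(\<lambda>n. M0 r - \<epsilon> n * (r powr d / (\<kappa> * d))) \<longlonglongrightarrow> M0 r - 0 * (r powr d / (\<kappa> * d))"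
        unfolding \<epsilon>_def
        by (rule tendsto_diff[OF tendsto_const tendsto_mult[OF LIMSEQ_inverse_real_of_nat tendsto_const]])+
      show ?thesis
        using LIMSEQ_le[OF lim] le by auto
    qed
  qed
qed

end

section \<open>The weak formulation\<close>

context radial_setting
begin

text \<open>A positive value c of \<open>M0\<close> persists towards 0 by monotonicity, while
  \<open>G\<close> tends to 0. Since d > 1, the factor r^(1-d) makes the slope of v as large as
  desired near 0; slope 2 is enough for the forbidden cone.\<close>

lemma flux_nonpos:
  assumes E: "countable E" and vc: "continuous_on {0<..<R} v"
    and deriv: "\<And>r. r \<in> {0<..<R} - E \<Longrightarrow>
      (v has_real_derivative spow (1 / (q - 1)) ((M0 r - G r) * r powr (1 - d))) (at r)"
    and mono: "\<And>r s. r \<in> {0<..<R} - E \<Longrightarrow> s \<in> {0<..<R} - E \<Longrightarrow> r \<le> s \<Longrightarrow> M0 s \<le> M0 r"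
    and s0: "s0 \<in> {0<..<R} - E"
  shows "M0 s0 \<le> 0"
proof (rule ccontr)
  assume "\<not> M0 s0 \<le> 0"
  define c where "c = M0 s0"
  have c: "c > 0" using \<open>\<not> M0 s0 \<le> 0\<close> by (simp add: c_def)
  have "(G \<longlongrightarrow> G 0) (at 0 within {0..s0})"
    using G_cont[of s0] s0 unfolding continuous_on_def by force
  then have "(G \<longlongrightarrow> 0) (at_right 0)"
    using s0 by (simp add: at_within_Icc_at_right)
  then have ev1: "\<forall>\<^sub>F r in at_right 0. G r < c / 2"
    using c by (intro order_tendstoD(2)) auto
  \<comment> \<open>This is the weighted flux r^(d-1) 2^(q-1) that belongs to slope 2.\<close>
  have "((\<lambda>r. r powr (d - 1) * 2 powr (q - 1)) \<longlongrightarrow> 0 powr (d - 1) * 2 powr (q - 1)) (at_right 0)"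
    by (intro tendsto_mult tendsto_const tendsto_powr' tendsto_ident_at)
      (use d_gt_1 in \<open>auto simp: eventually_at_filter\<close>)
  then have ev2: "\<forall>\<^sub>F r in at_right 0. r powr (d - 1) * 2 powr (q - 1) < c / 2"
    using c by (intro order_tendstoD(2)[where y = "0 powr (d - 1) * 2 powr (q - 1)"]) auto
  obtain \<delta>0 where \<delta>0: "\<delta>0 > 0"
    "\<And>r. 0 < r \<Longrightarrow> r < \<delta>0 \<Longrightarrow> G r < c / 2 \<and> r powr (d - 1) * 2 powr (q - 1) < c / 2"
    using eventually_conj[OF ev1 ev2] unfolding eventually_at_right_field by auto
  define \<delta> where "\<delta> = min \<delta>0 s0"
  have \<delta>: "\<delta> > 0" "\<delta> < R" using \<delta>0 s0 by (auto simp: \<delta>_def)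
  have steep: "2 \<le> spow (1 / (q - 1)) ((M0 r - G r) * r powr (1 - d))" if r: "0 < r" "r < \<delta>" "r \<notin> E" for r
  proof -
    have "c \<le> M0 r" unfolding c_def using r s0 by (intro mono) (auto simp: \<delta>_def)
    moreover have r1: "G r < c / 2" "r powr (d - 1) * 2 powr (q - 1) < c / 2"
      using \<delta>0(2)[of r] r by (auto simp: \<delta>_def)
    ultimately have "(r powr (d - 1) * 2 powr (q - 1)) * r powr (1 - d) \<le> (M0 r - G r) * r powr (1 - d)"
      by (intro mult_right_mono) auto
    moreover have "(r powr (d - 1) * 2 powr (q - 1)) * r powr (1 - d) = 2 powr (q - 1)"
      using r by (simp add: mult.commute mult.left_commute flip: powr_add)
    ultimately have "spow (1 / (q - 1)) (2 powr (q - 1)) \<le> spow (1 / (q - 1)) ((M0 r - G r) * r powr (1 - d))"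
      using q by (intro spow_mono) auto
    then show ?thesis using q by (simp add: spow_pos powr_powr)
  qed
  have incr: "v x + 2 * (y - x) \<le> v y" if xy: "0 < x" "x \<le> y" "y < \<delta>" for x y
  proof -
    have "v x - 2 * x \<le> v y - 2 * y"
    proof (rule nondecreasing_countable_exceptions[OF xy(2) _ E, of "\<lambda>x. v x - 2 * x"])
      show "continuous_on {x..y} (\<lambda>x. v x - 2 * x)"
        by (intro continuous_intros continuous_on_subset[OF vc]) (use xy \<delta> in auto)
      fix r assume r: "r \<in> {x<..<y} - E"
      have "((\<lambda>x. v x - 2 * x) has_real_derivative
          spow (1 / (q - 1)) ((M0 r - G r) * r powr (1 - d)) - 2) (at r)"
        using r xy \<delta> by (auto intro!: derivative_eq_intros deriv)
      then show "\<exists>D\<ge>0. ((\<lambda>x. v x - 2 * x) has_real_derivative D) (at r)"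
        using steep[of r] r xy by (intro exI[of _ "spow (1 / (q - 1)) ((M0 r - G r) * r powr (1 - d)) - 2"]) auto
    qed
    then show ?thesis by simp
  qed
  show False
  proof (rule no_corner_at_origin[OF \<delta>(1)])
    fix y assume y: "0 < y" "y < \<delta>"
    define x where "x n = y * inverse (real (Suc n))" for n
    have x: "0 < x n" "x n \<le> y" for n
      using y by (auto simp: x_def field_simps)
    have "x \<longlonglongrightarrow> y * 0"
      unfolding x_def by (intro tendsto_mult tendsto_const LIMSEQ_inverse_real_of_nat)
    then have x0: "x \<longlonglongrightarrow> 0" by simp
    \<comment> \<open>The cone based at \<open>x n\<close> > 0 is moved to the vertex 0;
      semicontinuity bounds v 0 from above, which is the direction required.\<close>
    have "v 0 \<le> v y - 2 * (y - 0)"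
    proof (rule v_le_lim[of x])
      show "(\<lambda>n. v y - 2 * (y - x n)) \<longlonglongrightarrow> v y - 2 * (y - 0)"
        by (intro tendsto_intros x0)
      show "v (x n) \<le> v y - 2 * (y - x n)" for n
        using incr[of "x n" y] x[of n] y by simp
      show "0 \<le> x n" "x n < R" for n using x[of n] y \<delta> by auto
    qed (use x0 R in auto)
    then show "v 0 + 2 * y \<le> v y" by simp
  qed
qed

end

text \<open>Here M - G is the flux r^(d-1) |v'|^(q-2) v'. \<open>M\<close> is monotone on all of
  [0,R), not just off \<open>E\<close>, and \<open>M 0 \<le> 0\<close> records the sign of its limit
  at the origin; the second mean value theorem is applied to it in this form.\<close>

locale radial_flux = radial_setting p q R f u k \<kappa> d
  for p q R f and u :: "real^'n::finite \<Rightarrow> real" and k \<kappa> d +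
  fixes E :: "real set" and M :: "real \<Rightarrow> real"
  assumes E: "countable E" and v_cont: "continuous_on {0<..<R} v"
    and M_mono: "\<And>r s. 0 \<le> r \<Longrightarrow> r \<le> s \<Longrightarrow> s < R \<Longrightarrow> M s \<le> M r"
    and M_0: "M 0 \<le> 0"
    and M_cont: "\<And>r. r \<in> {0<..<R} - E \<Longrightarrow> isCont M r"
    and v_deriv: "\<And>r. r \<in> {0<..<R} - E \<Longrightarrow>
      (v has_real_derivative spow (1 / (q - 1)) ((M r - G r) * r powr (1 - d))) (at r)"

text \<open>The supremum of \<open>M0\<close> over the nonexceptional points from r on is a monotone
  extension that agrees with \<open>M0\<close> off \<open>E\<close>. Its discontinuities are
  countable and join the exceptional set.\<close>

lemma (in radial_setting) ex_radial_flux: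
  obtains E M where "radial_flux p q R f u k \<kappa> d E M"
proof -
  obtain E M0 where E: "countable E" and vc: "continuous_on {0<..<R} v"
    and deriv: "\<And>r. r \<in> {0<..<R} - E \<Longrightarrow>
      (v has_real_derivative spow (1 / (q - 1)) ((M0 r - G r) * r powr (1 - d))) (at r)"
    and mono: "\<And>r s. r \<in> {0<..<R} - E \<Longrightarrow> s \<in> {0<..<R} - E \<Longrightarrow> r \<le> s \<Longrightarrow> M0 s \<le> M0 r"
    using ex_monotone_flux by blast
  have nonpos: "M0 r \<le> 0" if "r \<in> {0<..<R} - E" for r
    by (rule flux_nonpos[OF E vc deriv mono that])
  define S where "S r = {r..<R} \<inter> ({0<..<R} - E)" for r
  define M where "M r = (SUP s\<in>S r. M0 s)" for r
  have ne: "S r \<noteq> {}" if "0 \<le> r" "r < R" for r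
  proof
    assume "S r = {}"
    have "{r<..<R} \<subseteq> E"
    proof
      fix x assume "x \<in> {r<..<R}"
      then have "x \<in> {r..<R}" "x \<in> {0<..<R}" using that by auto
      then show "x \<in> E" using \<open>S r = {}\<close> unfolding S_def by blast
    qed
    then have "countable {r<..<R}" using E countable_subset by blast
    then show False using that uncountable_open_interval by blast
  qed
  have bdd: "bdd_above (M0 ` S r)" for r using nonpos by (auto simp: S_def intro!: bdd_aboveI2[of _ _ 0])
  have M_M0: "M r = M0 r" if "r \<in> {0<..<R} - E" for r
    unfolding M_def using that mono by (intro cSup_eq_maximum) (auto simp: S_def)
  have M_mono: "M s \<le> M r" if "0 \<le> r" "r \<le> s" "s < R" for r s
    unfolding M_def using that ne[of s] by (intro cSUP_subset_mono bdd) (auto simp: S_def)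
  define E' where "E' = E \<union> {r \<in> {0<..<R}. \<not> isCont M r}"
  have "mono_on {0<..<R} (\<lambda>r. - M r)" by (rule mono_onI) (auto intro: M_mono)
  then have "countable {r \<in> {0<..<R}. \<not> isCont (\<lambda>r. - M r) r}"
    by (intro mono_on_ctble_discont_open) auto
  then have "countable {r \<in> {0<..<R}. \<not> isCont M r}"
    by (rule countable_subset[rotated]) (auto dest: continuous_minus)
  then have E': "countable E'" using E by (simp add: E'_def)
  have "radial_flux p q R f u k \<kappa> d E' M"
  proof
    show "M 0 \<le> 0" unfolding M_def using ne[of 0] R nonpos by (intro cSUP_least) (auto simp: S_def)
    show "(v has_real_derivative spow (1 / (q - 1)) ((M r - G r) * r powr (1 - d))) (at r)"
      if "r \<in> {0<..<R} - E'" for r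
      using deriv[of r] M_M0[of r] that by (auto simp: E'_def)
  qed (use E' vc M_mono in \<open>auto simp: E'_def\<close>)
  then show thesis by (rule that)
qed

section \<open>Integrability of the derivative and the distributional identity\<close>

context radial_flux
begin

definition w :: "real \<Rightarrow> real" where
  "w r = spow (1 / (q - 1)) ((M r - G r) * r powr (1 - d))"

lemma q': "1 / (q - 1) > 0" using q by simp

lemma w_flux: "0 < r \<Longrightarrow> \<bar>w r\<bar> powr (q - 2) * w r * r powr (d - 1) = M r - G r"
  unfolding w_def spow_powr_cancel(1)[OF q] by (simp add: mult.assoc flip: powr_add)

lemma flux_measurable: "T < R \<Longrightarrow> (\<lambda>r. M r - G r) \<in> borel_measurable (lebesgue_on {0..T})"
proof -
  assume T: "T < R"
  have "mono_on {0..T} (\<lambda>r. - M r)" by (rule mono_onI) (use T M_mono in auto)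
  from borel_measurable_lebesgue_on_mono_on[OF this]
  have "(\<lambda>r. - (- M r)) \<in> borel_measurable (lebesgue_on {0..T})" by (rule borel_measurable_uminus)
  then have "M \<in> borel_measurable (lebesgue_on {0..T})" by simp
  moreover have "G \<in> borel_measurable (lebesgue_on {0..T})"
    by (rule continuous_imp_measurable_on_sets_lebesgue[OF G_cont[OF T]]) simp
  ultimately show ?thesis by (rule borel_measurable_diff)
qed

lemma flux_bounded:
  assumes "T < R" obtains K where "K \<ge> 0" "\<And>r. r \<in> {0..T} \<Longrightarrow> \<bar>M r - G r\<bar> \<le> K"
proof -
  have "bounded (G ` {0..T})"
    by (intro compact_imp_bounded compact_continuous_image G_cont assms) simp
  then obtain B where B: "\<And>r. r \<in> {0..T} \<Longrightarrow> \<bar>G r\<bar> \<le> B" unfolding bounded_iff by fastforce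
  have "\<bar>M r - G r\<bar> \<le> \<bar>M T\<bar> + \<bar>B\<bar>" if r: "r \<in> {0..T}" for r
    using M_mono[of 0 r] M_mono[of r T] M_0 B[OF r] r assms by auto
  then show thesis by (intro that[of "\<bar>M T\<bar> + \<bar>B\<bar>"]) auto
qed

lemma w_measurable: "T < R \<Longrightarrow> w \<in> borel_measurable (lebesgue_on {0..T})"
proof -
  assume T: "T < R"
  have "(\<lambda>r::real. r powr (1 - d)) \<in> borel_measurable borel" by measurable
  then have "(\<lambda>r::real. r powr (1 - d)) \<in> borel_measurable lebesgue"
    by (intro measurable_completion) simp
  then have "(\<lambda>r::real. r powr (1 - d)) \<in> borel_measurable (lebesgue_on {0..T})"
    by (rule measurable_restrict_space1)
  then have "(\<lambda>r. (M r - G r) * r powr (1 - d)) \<in> borel_measurable (lebesgue_on {0..T})"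
    by (intro borel_measurable_times flux_measurable[OF T])
  from measurable_compose[OF this borel_measurable_continuous_onI[OF continuous_spow[OF q']]]
  show ?thesis by (simp add: w_def[abs_def])
qed

lemma w_cont: "r \<in> {0<..<R} - E \<Longrightarrow> isCont w r"
proof -
  assume r: "r \<in> {0<..<R} - E"
  have "isCont (\<lambda>r. (M r - G r) * r powr (1 - d)) r"
    using r by (intro continuous_intros M_cont DERIV_isCont[OF G_deriv]) auto
  moreover have "isCont (spow (1 / (q - 1))) x" for x
    using continuous_spow[OF q'] continuous_on_eq_continuous_at by blast
  ultimately show ?thesis
    unfolding w_def[abs_def] by (rule isCont_o2)
qed

lemma w_abs_int_pos:
  assumes "0 < s" "t < R"
  shows "w absolutely_integrable_on {s..t}"
proof -
  obtain K where K: "K \<ge> 0" "\<And>r. r \<in> {0..t} \<Longrightarrow> \<bar>M r - G r\<bar> \<le> K" using flux_bounded assms(2) by metis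
  have "\<bar>w r\<bar> \<le> (K * s powr (1 - d)) powr (1 / (q - 1))" if r: "r \<in> {s..t}" for r
  proof -
    have "r powr (1 - d) \<le> s powr (1 - d)" using r assms d_gt_1 by (intro powr_mono2') auto
    then have "\<bar>(M r - G r) * r powr (1 - d)\<bar> \<le> K * s powr (1 - d)"
      unfolding abs_mult using K r assms by (intro mult_mono) auto
    then show ?thesis unfolding w_def abs_spow using q' by (intro powr_mono2) auto
  qed
  moreover have "w \<in> borel_measurable (lebesgue_on {s..t})"
    using w_measurable[OF assms(2)] by (rule measurable_restrict_mono) (use assms in auto)
  ultimately show ?thesis by (intro absolutely_integrable_bounded)
qed

lemma integral_w:
  assumes "0 < s" "s \<le> t" "t < R"
  shows "integral {s..t} w = v t - v s"
proof (rule fundamental_theorem_countable_exceptions[OF assms(2) _ _ E])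
  show "continuous_on {s..t} v" by (rule continuous_on_subset[OF v_cont]) (use assms in auto)
  show "w integrable_on {s..t}" using w_abs_int_pos assms by (auto intro: set_lebesgue_integral_eq_integral(1))
  show "(v has_real_derivative w r) (at r)" if "r \<in> {s<..<t} - E" for r
    unfolding w_def using that assms by (intro v_deriv) auto
  show "isCont w r" if "r \<in> {s<..<t} - E" for r
    using that assms by (intro w_cont) auto
qed

text \<open>As M \<le> 0, only -G can make the flux positive, and |G r| \<le> B r^d/\<kappa> because
  the weight is increasing. The factor r^(1-d) leaves B r/\<kappa>. There is no such bound from
  below: M may stay under a negative constant while r^(1-d) blows up.\<close>

lemma w_bounded_above:
  assumes "0 < T" "T < R" obtains C where "C \<ge> 0" "\<And>r. r \<in> {0..T} \<Longrightarrow> w r \<le> C"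
proof -
  have "bounded (f ` {0..T})"
    by (intro compact_imp_bounded compact_continuous_image continuous_on_subset[OF contf]) (use assms in auto)
  then obtain B where B: "\<And>r. r \<in> {0..T} \<Longrightarrow> \<bar>f r\<bar> \<le> B" unfolding bounded_iff by fastforce
  have "B \<ge> 0" using B[of 0] assms by auto
  define C where "C = spow (1 / (q - 1)) (B * T / \<kappa>)"
  have C: "C \<ge> 0" using \<open>B \<ge> 0\<close> assms kappa_pos by (simp add: C_def spow_pos)
  have "w r \<le> C" if r: "r \<in> {0..T}" for r
  proof (cases "r = 0")
    case True
    then show ?thesis using C by (simp add: w_def)
  next
    case False
    then have r0: "r > 0" using r by simp
    have "norm (integral {0..r} (\<lambda>s. f s * s powr (d - 1))) \<le> (B * r powr (d - 1)) * (r - 0)"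
    proof (rule integral_bound)
      show "continuous_on {0..r} (\<lambda>s. f s * s powr (d - 1))" using r assms by (intro weighted_f_cont) auto
      show "norm (f t * t powr (d - 1)) \<le> B * r powr (d - 1)" if t: "t \<in> {0..r}" for t
      proof -
        have "t powr (d - 1) \<le> r powr (d - 1)" using t d_gt_1 by (intro powr_mono2) auto
        then show ?thesis unfolding norm_mult using t r B[of t] by (intro mult_mono) auto
      qed
    qed (use r in auto)
    then have "\<bar>G r\<bar> \<le> B * r powr (d - 1) * r / \<kappa>"
      using kappa_pos by (simp add: G_def divide_right_mono)
    then have "M r - G r \<le> B * r powr (d - 1) * r / \<kappa>"
      using M_mono[of 0 r] M_0 r assms by auto
    then have "(M r - G r) * r powr (1 - d) \<le> (B * r powr (d - 1) * r / \<kappa>) * r powr (1 - d)"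
      by (intro mult_right_mono) auto
    also have "\<dots> = (B * r / \<kappa>) * (r powr (d - 1) * r powr (1 - d))" by simp
    also have "r powr (d - 1) * r powr (1 - d) = 1" using r0 by (simp flip: powr_add)
    also have "(B * r / \<kappa>) * 1 \<le> B * T / \<kappa>"
      using r kappa_pos \<open>B \<ge> 0\<close> by (simp add: divide_right_mono mult_left_mono)
    finally show ?thesis unfolding w_def C_def by (intro spow_mono q')
  qed
  with C show thesis by (rule that)
qed

text \<open>Although \<open>w\<close> may be unbounded near 0, it is bounded above and \<open>v\<close> is bounded.\<close>

lemma w_abs_int:
  assumes T: "0 < T" "T < R"
  shows "w absolutely_integrable_on {0..T}"
proof -
  obtain C where C: "C \<ge> 0" "\<And>r. r \<in> {0..T} \<Longrightarrow> w r \<le> C" using w_bounded_above T by metis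
  obtain B where B: "\<And>r. 0 \<le> r \<Longrightarrow> r < R \<Longrightarrow> \<bar>v r\<bar> \<le> B" using v_bounded by metis
  define s where "s n = T * inverse (real (Suc n))" for n
  have s: "0 < s n" "s n \<le> T" "s (Suc n) \<le> s n" for n
    using T by (auto simp: s_def field_simps)
  define g where "g r = (if r \<in> {0<..T} then C - w r else 0)" for r
  define F where "F n r = (if r \<in> {s n..T} then C - w r else 0)" for n r
  have int: "((\<lambda>r. C - w r) has_integral (C * (T - s n) - (v T - v (s n)))) {s n..T}" for n
  proof (rule has_integral_diff)
    show "((\<lambda>r. C) has_integral C * (T - s n)) {s n..T}"
      using has_integral_const_real[of C "s n" T] s[of n] by (simp add: mult.commute)
    have "w integrable_on {s n..T}"
      using w_abs_int_pos[of "s n" T] s T by (auto intro: set_lebesgue_integral_eq_integral(1))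
    then show "(w has_integral v T - v (s n)) {s n..T}"
      using integral_w[of "s n" T] s T by (simp add: has_integral_iff)
  qed
  have F: "(F n has_integral (C * (T - s n) - (v T - v (s n)))) {0..T}" for n
    unfolding F_def using int[of n] s[of n] by (subst has_integral_restrict) (auto intro: order_trans)
  \<comment> \<open>The truncations \<open>F n\<close> of the nonnegative C - w increase, and their
    integrals stay bounded because the integral of w over [s n, T] is an increment of the bounded
    v.\<close>
  have "g integrable_on {0..T} \<and> (\<lambda>n. integral {0..T} (F n)) \<longlonglongrightarrow> integral {0..T} g"
  proof (rule monotone_convergence_increasing)
    show "F n integrable_on {0..T}" for n using F by blast
    show "F n r \<le> F (Suc n) r" if "r \<in> {0..T}" for n r
      using C(2)[OF that] s(3)[of n] that by (auto simp: F_def)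
    show "(\<lambda>n. F n r) \<longlonglongrightarrow> g r" if "r \<in> {0..T}" for r
    proof (cases "r = 0")
      case True
      then have "F n r = 0" for n using s(1)[of n] by (auto simp: F_def)
      then show ?thesis using True by (simp add: g_def)
    next
      case False
      have "s \<longlonglongrightarrow> T * 0"
        unfolding s_def by (intro tendsto_mult tendsto_const LIMSEQ_inverse_real_of_nat)
      then have "\<forall>\<^sub>F n in sequentially. s n < r"
        using False that by (intro order_tendstoD(2)) auto
      then have "\<forall>\<^sub>F n in sequentially. F n r = g r"
        by eventually_elim (use that False in \<open>auto simp: F_def g_def\<close>)
      then show ?thesis by (rule tendsto_eventually)
    qed
    have "\<bar>integral {0..T} (F n)\<bar> \<le> C * T + 2 * B" for n
    proof -
      have "0 \<le> C * (T - s n)" "C * (T - s n) \<le> C * T"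
        using s[of n] C by (auto intro: mult_left_mono)
      then show ?thesis
        using integral_unique[OF F[of n]] B[of T] B[of "s n"] s[of n] T by auto
    qed
    then show "bounded (range (\<lambda>n. integral {0..T} (F n)))"
      unfolding bounded_iff by auto
  qed
  then have "g absolutely_integrable_on {0..T}"
    using C by (intro nonnegative_absolutely_integrable_1) (auto simp: g_def)
  moreover have "(\<lambda>r. C) absolutely_integrable_on {0..T}"
    by (intro absolutely_integrable_continuous_real continuous_intros)
  ultimately have "(\<lambda>r. C - g r) absolutely_integrable_on {0..T}"
    by (intro set_integral_diff)
  then show ?thesis
    by (rule absolutely_integrable_spike[of _ _ "{0}"]) (auto simp: g_def)
qed

lemma v_abs_int: "0 < s \<Longrightarrow> t < R \<Longrightarrow> v absolutely_integrable_on {s..t}"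
  by (intro absolutely_integrable_continuous_real continuous_on_subset[OF v_cont]) auto

text \<open>Off \<open>E\<close> the product rule holds classically for v \<phi>, so the fundamental
  theorem with countable exceptions applies. The boundary terms vanish because \<phi> is 0 at s and
  t.\<close>

lemma distributional_derivative:
  assumes b: "0 < b" "b \<le> R"
  shows "has_distributional_derivative v w 0 b"
  unfolding has_distributional_derivative_def locally_integrable_on_def
proof (intro conjI allI impI ballI)
  fix K assume K: "compact K \<and> K \<subseteq> {0<..<b}"
  then obtain s t where st': "0 < s" "s < t" "t < b" "K \<subseteq> {s<..<t}"
    using compact_in_open_interval[of K 0 b] b(1) by metis
  then have st: "0 < s" "t < b" "K \<subseteq> {s..t}" by auto
  have "K \<in> sets lebesgue" using K lmeasurable_compact by blast
  then show "set_integrable lebesgue K v" "set_integrable lebesgue K w"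
    using st b set_integrable_subset[OF v_abs_int[of s t]] set_integrable_subset[OF w_abs_int_pos[of s t]] by auto
next
  fix \<phi> assume \<phi>: "\<phi> \<in> test_functions 0 b"
  obtain s t where st: "0 < s" "s < t" "t < b" and z: "\<And>x. x \<notin> {s<..<t} \<Longrightarrow> \<phi> x = 0 \<and> deriv \<phi> x = 0"
    using test_function_support[OF \<phi> b(1)] by blast
  note sm = test_function_smooth[OF \<phi>]
  have vc: "continuous_on {s..t} v" by (rule continuous_on_subset[OF v_cont]) (use st b in auto)
  have "bounded (\<phi> ` {s..t})" by (intro compact_imp_bounded compact_continuous_image sm) simp
  then have i1: "(\<lambda>x. \<phi> x * w x) absolutely_integrable_on {s..t}"
    using st b by (intro absolutely_integrable_bounded_measurable_product_real w_abs_int_pos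
        continuous_imp_measurable_on_sets_lebesgue sm) auto
  have i2: "(\<lambda>x. v x * deriv \<phi> x) absolutely_integrable_on {s..t}"
    by (intro absolutely_integrable_continuous_real continuous_intros vc sm)
  have j: "(\<lambda>x. \<phi> x * w x) integrable_on {s..t}" "(\<lambda>x. v x * deriv \<phi> x) integrable_on {s..t}"
    using i1 i2 set_lebesgue_integral_eq_integral(1) by blast+
  have "integral {s..t} (\<lambda>x. \<phi> x * w x + v x * deriv \<phi> x) = v t * \<phi> t - v s * \<phi> s"
  proof (rule fundamental_theorem_countable_exceptions[OF _ _ _ E, where h = "\<lambda>x. v x * \<phi> x"])
    show "(\<lambda>x. \<phi> x * w x + v x * deriv \<phi> x) integrable_on {s..t}"
      by (intro integrable_add j)
    show "((\<lambda>x. v x * \<phi> x) has_real_derivative \<phi> x * w x + v x * deriv \<phi> x) (at x)" if "x \<in> {s<..<t} - E" for x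
      unfolding w_def using that st b by (auto intro!: derivative_eq_intros sm v_deriv)
    show "isCont (\<lambda>x. \<phi> x * w x + v x * deriv \<phi> x) x" if x: "x \<in> {s<..<t} - E" for x
    proof -
      have "isCont \<phi> x" "isCont (deriv \<phi>) x" using sm(2,3)[of UNIV] by (auto simp: continuous_on_eq_continuous_at)
      moreover have "isCont v x" "isCont w x" using x st b v_cont w_cont[of x]
        by (auto simp: continuous_on_eq_continuous_at)
      ultimately show ?thesis by (intro continuous_intros)
    qed
  qed (use st in \<open>auto intro!: continuous_intros vc sm\<close>)
  then have "integral {s..t} (\<lambda>x. \<phi> x * w x) + integral {s..t} (\<lambda>x. v x * deriv \<phi> x) = 0"
    using z[of s] z[of t] by (simp add: Henstock_Kurzweil_Integration.integral_add j)
  moreover have "(LINT r:{0<..<b}|lebesgue. v r * deriv \<phi> r) = integral {s..t} (\<lambda>x. v x * deriv \<phi> x)"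
    by (rule set_integral_restrict(2)[OF i2]) (use st z in auto)
  moreover have "(LINT r:{0<..<b}|lebesgue. w r * \<phi> r) = integral {s..t} (\<lambda>x. \<phi> x * w x)"
    by (rule set_integral_restrict(2)[OF i1]) (use st z in auto)
  ultimately show "(LINT r:{0<..<b}|lebesgue. v r * deriv \<phi> r) = - (LINT r:{0<..<b}|lebesgue. w r * \<phi> r)"
    by simp
qed

lemma v_weighted_Lq:
  assumes T: "0 < T" "T < R"
  shows "v \<in> weighted_Lq q d T"
  unfolding weighted_Lq_def
proof (intro CollectI conjI)
  have vc: "continuous_on {0<..<T} v" by (rule continuous_on_subset[OF v_cont]) (use T in auto)
  show "set_borel_measurable lebesgue {0<..<T} v"
    using continuous_imp_measurable_on_sets_lebesgue[OF vc]
    by (simp add: set_borel_measurable_def borel_measurable_restrict_space_iff)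
  obtain B where B: "\<And>r. 0 \<le> r \<Longrightarrow> r < R \<Longrightarrow> \<bar>v r\<bar> \<le> B" using v_bounded by metis
  show "set_integrable lebesgue {0<..<T} (\<lambda>r. \<bar>v r\<bar> powr q * r powr (d - 1))"
  proof (rule measurable_bounded_by_integrable_imp_absolutely_integrable)
    have "continuous_on {0<..<T} (\<lambda>r. \<bar>v r\<bar> powr q * r powr (d - 1))"
      using q d_gt_1 by (intro continuous_on_mult continuous_on_powr' continuous_on_rabs vc continuous_on_id
          continuous_on_const) auto
    then show "(\<lambda>r. \<bar>v r\<bar> powr q * r powr (d - 1)) \<in> borel_measurable (lebesgue_on {0<..<T})"
      by (rule continuous_imp_measurable_on_sets_lebesgue) simp
    show "(\<lambda>r. B powr q * T powr (d - 1)) integrable_on {0<..<T}"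
      unfolding integrable_on_Icc_iff_Ioo[symmetric] by (intro integrable_continuous_real continuous_intros)
    show "norm (\<bar>v r\<bar> powr q * r powr (d - 1)) \<le> B powr q * T powr (d - 1)" if "r \<in> {0<..<T}" for r
      unfolding norm_mult using that T B[of r] q d_gt_1 by (simp, intro mult_mono powr_mono2) auto
  qed simp
qed

text \<open>The integrand |w|^q r^(d-1) equals |M - G| |w|, a bounded flux times an integrable
  function, so the weighted q-th power is controlled by the unweighted first power.\<close>

lemma w_weighted_Lq:
  assumes T: "0 < T" "T < R"
  shows "w \<in> weighted_Lq q d T"
  unfolding weighted_Lq_def
proof (intro CollectI conjI)
  have "w \<in> borel_measurable (lebesgue_on {0<..<T})"
    using w_measurable[OF T(2)] by (rule measurable_restrict_mono) auto
  then show "set_borel_measurable lebesgue {0<..<T} w"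
    by (simp add: set_borel_measurable_def borel_measurable_restrict_space_iff)
  obtain K where K: "K \<ge> 0" "\<And>r. r \<in> {0..T} \<Longrightarrow> \<bar>M r - G r\<bar> \<le> K" using flux_bounded T(2) by metis
  have "(\<lambda>r. (M r - G r) * w r) absolutely_integrable_on {0..T}"
    using K T by (intro absolutely_integrable_bounded_measurable_product_real w_abs_int flux_measurable)
      (auto simp: bounded_iff intro!: exI[of _ K])
  then have "(\<lambda>r. \<bar>(M r - G r) * w r\<bar>) absolutely_integrable_on {0..T}"
    using set_integrable_abs by blast
  then show "set_integrable lebesgue {0<..<T} (\<lambda>r. \<bar>w r\<bar> powr q * r powr (d - 1))"
  proof (rule set_integral_restrict(1))
    fix r assume "r \<in> {0<..<T}"
    then have r: "r > 0" by simp
    have "\<bar>(M r - G r) * w r\<bar> = \<bar>w r\<bar> powr (q - 2) * (\<bar>w r\<bar> * \<bar>w r\<bar>) * r powr (d - 1)"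
      unfolding w_flux[OF r, symmetric] by (simp add: abs_mult)
    also have "\<bar>w r\<bar> powr (q - 2) * (\<bar>w r\<bar> * \<bar>w r\<bar>) = \<bar>w r\<bar> powr q"
      using powr_add[of "\<bar>w r\<bar>" "q - 2" 2] by (simp add: power2_eq_square)
    finally show "\<bar>w r\<bar> powr q * r powr (d - 1) = \<bar>(M r - G r) * w r\<bar>" by simp
  qed auto
qed

text \<open>The term with \<open>f\<close> is absorbed by integrating \<open>G \<phi>\<close>; the remaining integral of \<open>M \<phi>'\<close> has a sign by the
  second mean value theorem, as \<open>-M\<close> is nonnegative and nondecreasing.\<close>

lemma weak_inequality:
  assumes \<phi>: "\<phi> \<in> test_functions (- R) R" and nonneg: "\<And>r. \<phi> r \<ge> 0"
  defines "I \<equiv> \<lambda>r. \<kappa> * \<bar>w r\<bar> powr (q - 2) * w r * deriv \<phi> r * r powr (d - 1) - \<phi> r * f r * r powr (d - 1)"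
  shows "set_integrable lebesgue {0<..<R} I" "(LINT r:{0<..<R}|lebesgue. I r) \<ge> 0"
proof -
  have "- R < R" using R by simp
  from test_function_support[OF \<phi> this] obtain s t where
    st: "t < R" and z': "\<And>x. x \<notin> {s<..<t} \<Longrightarrow> \<phi> x = 0 \<and> deriv \<phi> x = 0" by metis
  \<comment> \<open>The support of \<phi> may lie in the negative half-line; the maximum with R/2
    keeps T positive.\<close>
  define T where "T = max t (R / 2)"
  have T: "0 < T" "T < R" using st R by (auto simp: T_def)
  have z: "\<phi> x = 0" "deriv \<phi> x = 0" if "T \<le> x" for x using z'[of x] that by (auto simp: T_def)
  note sm = test_function_smooth[OF \<phi>]
  define h where "h r = f r * r powr (d - 1)" for r
  have hc: "continuous_on {0..T} h" unfolding h_def by (rule weighted_f_cont[OF T(2)])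
  have Gc: "continuous_on {0..T} G" by (rule G_cont[OF T(2)])
  have "(\<lambda>r. - (- M r)) \<in> borel_measurable (lebesgue_on {0..T})"
    by (intro borel_measurable_uminus borel_measurable_lebesgue_on_mono_on mono_onI) (use T M_mono in auto)
  then have "(\<lambda>r. M r) absolutely_integrable_on {0..T}"
    using M_mono[of 0] M_mono[of _ T] M_0 T by (intro absolutely_integrable_bounded[of _ _ _ "- M T"]) fastforce+
  moreover have "bounded (deriv \<phi> ` {0..T})" by (intro compact_imp_bounded compact_continuous_image sm) simp
  ultimately have i1: "(\<lambda>r. deriv \<phi> r * M r) absolutely_integrable_on {0..T}"
    by (intro absolutely_integrable_bounded_measurable_product_real
        continuous_imp_measurable_on_sets_lebesgue sm) auto
  define J2 where "J2 r = \<kappa> * G r * deriv \<phi> r + \<phi> r * h r" for r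
  have J2c: "continuous_on {0..T} J2" unfolding J2_def by (intro continuous_intros Gc hc sm)
  have i2: "J2 absolutely_integrable_on {0..T}" by (rule absolutely_integrable_continuous_real[OF J2c])
  define J where "J r = \<kappa> * (deriv \<phi> r * M r) - J2 r" for r
  have i: "J absolutely_integrable_on {0..T}"
    unfolding J_def by (intro set_integral_diff(1) set_integrable_mult_right i1 i2)
  have IJ: "I r = J r" if "r > 0" for r
  proof -
    have "I r = \<kappa> * (\<bar>w r\<bar> powr (q - 2) * w r * r powr (d - 1)) * deriv \<phi> r - \<phi> r * h r"
      by (simp add: I_def h_def)
    then show ?thesis unfolding w_flux[OF that] by (simp add: J_def J2_def algebra_simps)
  qed
  have I0: "I r = 0" if "T \<le> r" for r using z[OF that] by (simp add: I_def)
  show "set_integrable lebesgue {0<..<R} I"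
    by (rule set_integral_restrict(1)[OF i]) (use T IJ I0 in auto)
  have "(LINT r:{0<..<R}|lebesgue. I r) = integral {0..T} J"
    by (rule set_integral_restrict(2)[OF i]) (use T IJ I0 in auto)
  also have "integral {0..T} J = integral {0..T} (\<lambda>r. \<kappa> * (deriv \<phi> r * M r)) - integral {0..T} J2"
    unfolding J_def
    by (intro Henstock_Kurzweil_Integration.integral_diff set_lebesgue_integral_eq_integral(1)
        set_integrable_mult_right i1 i2)
  also have "integral {0..T} (\<lambda>r. \<kappa> * (deriv \<phi> r * M r)) = \<kappa> * integral {0..T} (\<lambda>r. deriv \<phi> r * M r)"
    by simp
  \<comment> \<open>\<open>J2\<close> is the derivative of \<kappa> G \<phi>, and both boundary
    terms vanish: \<phi> is 0 at T and \<open>G\<close> is 0 at 0.\<close>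
  also have "integral {0..T} J2 = 0"
  proof -
    have "(J2 has_integral \<kappa> * (G T * \<phi> T) - \<kappa> * (G 0 * \<phi> 0)) {0..T}"
    proof (rule fundamental_theorem_of_calculus)
      fix r assume r: "r \<in> {0..T}"
      have "((\<lambda>r. \<kappa> * (G r * \<phi> r)) has_real_derivative J2 r) (at r within {0..T})"
        using r T kappa_pos
        by (auto intro!: derivative_eq_intros G_within has_field_derivative_at_within[OF sm(1)]
            simp: J2_def h_def field_simps)
      then show "((\<lambda>r. \<kappa> * (G r * \<phi> r)) has_vector_derivative J2 r) (at r within {0..T})"
        by (simp add: has_real_derivative_iff_has_vector_derivative)
    qed (use T in simp)
    then show ?thesis using z[of T] by (simp add: integral_unique)
  qed
  also have "\<kappa> * integral {0..T} (\<lambda>r. deriv \<phi> r * M r) - 0 \<ge> 0"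
  proof -
    have ftc: "integral {a..b} (deriv \<phi>) = \<phi> b - \<phi> a" if "a \<le> b" for a b
      by (intro integral_unique fundamental_theorem_of_calculus that)
        (use sm(1) in \<open>auto simp flip: has_real_derivative_iff_has_vector_derivative intro: has_field_derivative_at_within\<close>)
    have "deriv \<phi> integrable_on {0..T}" by (intro integrable_continuous_real sm)
    moreover have "- M x \<le> - M y" if "0 \<le> x" "x \<le> y" "y \<le> T" for x y
      using M_mono[of x y] that T by simp
    ultimately obtain c where c: "c \<in> {0..T}"
      "integral {0..T} (\<lambda>x. - M x * deriv \<phi> x) = - M 0 * integral {0..c} (deriv \<phi>) + - M T * integral {c..T} (deriv \<phi>)"
      using second_mean_value_theorem[of "deriv \<phi>" 0 T "\<lambda>x. - M x"] T by auto
    have "integral {0..T} (\<lambda>x. - M x * deriv \<phi> x) = - integral {0..T} (\<lambda>r. deriv \<phi> r * M r)"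
      by (simp add: mult.commute flip: integral_neg)
    then have "integral {0..T} (\<lambda>r. deriv \<phi> r * M r) = M 0 * (\<phi> c - \<phi> 0) + M T * (\<phi> T - \<phi> c)"
      using c by (simp add: ftc)
    \<comment> \<open>Because \<phi> 0 may be positive, the second summand calls for M 0 \<le> 0;
      the first is nonnegative by monotonicity alone.\<close>
    also have "\<dots> = (M 0 - M T) * \<phi> c + (- M 0) * \<phi> 0"
      using z[of T] by (simp add: algebra_simps)
    also have "\<dots> \<ge> 0"
      using M_mono[of 0 T] M_0 T nonneg by (intro add_nonneg_nonneg mult_nonneg_nonneg) auto
    finally show ?thesis using kappa_pos by simp
  qed
  finally show "(LINT r:{0<..<R}|lebesgue. I r) \<ge> 0" .
qed

lemma weak_supersolution_v: "weak_supersolution \<kappa> q d f R v"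
  unfolding weak_supersolution_def weighted_W1q_def
  using v_weighted_Lq w_weighted_Lq distributional_derivative R weak_inequality
  by (intro conjI ballI exI[of _ w] CollectI bexI[of _ w] impI) auto

end

theorem theorem4p1:
  fixes p q R \<kappa> d :: real
    and f :: "real \<Rightarrow> real"
    and u :: "real^'n::finite \<Rightarrow> real"
    and k :: 'n
  assumes "CARD('n) \<ge> 2"
    and "1 < p" and "1 < q" and "0 < R"
    and "continuous_on {0..<R} f"
    and "\<kappa> = (p - 1) / (q - 1)"
    and "d = (real CARD('n) - 1) * (q - 1) / (p - 1) + 1"
    and "viscosity_supersolution p q f R u"
    and "radial_on (ball 0 R) u"
  shows "weak_supersolution \<kappa> q d f R (\<lambda>r. u (r *\<^sub>R axis k 1))"
proof -
  interpret radial_setting p q R f u k \<kappa> d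
    by unfold_locales (use assms in auto)
  obtain E M where "radial_flux p q R f u k \<kappa> d E M" by (rule ex_radial_flux)
  then interpret radial_flux p q R f u k \<kappa> d E M .
  show ?thesis using weak_supersolution_v by (simp add: v_def[abs_def])
qed

end
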